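(* Let $d\ge 2$ and $0<a<b$, and for $k\ge1$ let $$\mathcal U_k=\frac1{b-a}\sup\{\partial_Sf_n(\omega): n\in\mathbb N, S\subseteq W_n, |S|=k,\omega\in\Omega_n\},$$ $$\mathcal L_k=\frac1{b-a}\inf\{\partial_Sf_n(\omega): n\in\mathbb N, S\subseteq W_n, |S|=k,\omega\in\Omega_n\}.$$ Then: (i) for all $k\ge1$, $\ \mathcal U_{k+1}\leq\mathcal U_k-\mathcal L_k$ and $\mathcal L_{k+1}\geq\mathcal L_k-\mathcal U_k$; (ii) for all $k\ge2$, $\ \mathcal U_k\leq 2^{k-2}$ and $|\mathcal L_k|\leq 2^{k-2}$; (iii) for all integers $k\ge2$, $$\mathcal U_k\geq\binom{k-2}{\lceil\frac{k-2}2\rceil}\quad\text{and}\quad|\mathcal L_k|\geq\binom{k-2}{\lceil\frac{k-2}2\rceil}.$$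
   Context: For $n\in\mathbb N$ consider the subgraph of the nearest-neighbor lattice $\mathbb Z^d$ induced by the box $[-2n,2n]^d$; $W_n$ is its set of edges and $\Omega_n=\{a,b\}^{W_n}$ is the set of environments (assignments of passage times $a$ or $b$ to edges). The passage time of a path in $\omega$ is the sum of the values of its edges. A nonzero vector $v\in\mathbb Z^d$ with $nv\in[-2n,2n]^d$ is fixed, and $f_n(\omega)$ is the minimal passage time over all paths in the box from the vertex $0$ to the vertex $nv$. For an edge $j$ and $\delta\in\{a,b\}$, $\sigma_j^\delta:\Omega_n\to\Omega_n$ replaces the $j$-th coordinate by $\delta$ and leaves the others unchanged. For $\varphi:\Omega_n\to\mathbb R$, $\partial_j\varphi=\varphi\circ\sigma_j^b-\varphi\circ\sigma_j^a$. For nonempty $S\subseteq W_n$, $\partial_S\varphi$ is obtained by applying successively all $\partial_j$, $j\in S$ (the order does not matter). *)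

theory Defs
  imports "HOL-Analysis.Analysis"
begin

type_synonym 'd env = "(int ^ 'd) set \<Rightarrow> real"

definition adjacent :: "int ^ 'd \<Rightarrow> int ^ 'd \<Rightarrow> bool" where
  "adjacent x y \<longleftrightarrow> (\<Sum>i\<in>UNIV. \<bar>x $ i - y $ i\<bar>) = 1"

definition box_vertices :: "nat \<Rightarrow> (int ^ 'd) set" where
  "box_vertices n = {x. \<forall>i. - 2 * int n \<le> x $ i \<and> x $ i \<le> 2 * int n}"

definition box_edges :: "nat \<Rightarrow> (int ^ 'd) set set" where
  "box_edges n = {{x, y} | x y. x \<in> box_vertices n \<and> y \<in> box_vertices n \<and> adjacent x y}"

definition environments :: "real \<Rightarrow> real \<Rightarrow> nat \<Rightarrow> 'd::finite env set" where
  "environments a b n = (box_edges n \<rightarrow>\<^sub>E {a, b})"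

text \<open>Paths have pairwise distinct vertices, so a box contains finitely many of them and the minimum
  below is attained. Allowing repeated vertices would not change it for positive passage times.\<close>

definition box_paths :: "nat \<Rightarrow> int ^ 'd \<Rightarrow> int ^ 'd \<Rightarrow> (int ^ 'd) list set" where
  "box_paths n x y = {p. p \<noteq> [] \<and> hd p = x \<and> last p = y \<and> set p \<subseteq> box_vertices n \<and>
     distinct p \<and> successively adjacent p}"

definition passage_time :: "'d::finite env \<Rightarrow> (int ^ 'd) list \<Rightarrow> real" where
  "passage_time \<omega> p = (\<Sum>i<length p - 1. \<omega> {p ! i, p ! Suc i})"

definition first_passage_time :: "int ^ 'd \<Rightarrow> nat \<Rightarrow> 'd::finite env \<Rightarrow> real" where
  "first_passage_time v n \<omega> = Min (passage_time \<omega> ` box_paths n 0 (int n *s v))"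

definition set_edge :: "'e \<Rightarrow> real \<Rightarrow> ('e \<Rightarrow> real) \<Rightarrow> ('e \<Rightarrow> real)" where
  "set_edge j \<delta> \<omega> = fun_upd \<omega> j \<delta>"

definition env_deriv :: "real \<Rightarrow> real \<Rightarrow> 'e \<Rightarrow> (('e \<Rightarrow> real) \<Rightarrow> real) \<Rightarrow> (('e \<Rightarrow> real) \<Rightarrow> real)" where
  "env_deriv a b j \<phi> = (\<lambda>\<omega>. \<phi> (set_edge j b \<omega>) - \<phi> (set_edge j a \<omega>))"

definition env_deriv_set ::
  "real \<Rightarrow> real \<Rightarrow> 'e set \<Rightarrow> (('e \<Rightarrow> real) \<Rightarrow> real) \<Rightarrow> (('e \<Rightarrow> real) \<Rightarrow> real)" where
  "env_deriv_set a b S \<phi> = Finite_Set.fold (env_deriv a b) \<phi> S"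

definition deriv_values :: "real \<Rightarrow> real \<Rightarrow> int ^ 'd \<Rightarrow> nat \<Rightarrow> real set" where
  "deriv_values a b v k =
     {env_deriv_set a b S (first_passage_time v n) \<omega> | n S \<omega>.
        S \<subseteq> box_edges n \<and> card S = k \<and> \<omega> \<in> environments a b n}"

text \<open>For \<open>k \<ge> 1\<close> the set of values is nonempty and, since a first-order derivative of the first passage
  time lies in \<open>{0..b - a}\<close>, bounded; so its supremum and infimum are genuine real numbers.\<close>

definition sup_deriv :: "real \<Rightarrow> real \<Rightarrow> int ^ 'd \<Rightarrow> nat \<Rightarrow> real" where
  "sup_deriv a b v k = 1 / (b - a) * Sup (deriv_values a b v k)"

definition inf_deriv :: "real \<Rightarrow> real \<Rightarrow> int ^ 'd \<Rightarrow> nat \<Rightarrow> real" where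
  "inf_deriv a b v k = 1 / (b - a) * Inf (deriv_values a b v k)"

text \<open>The order of differentiation is irrelevant, so the fold over a finite set is determined by
  its recursion equations.\<close>

lemma comp_fun_commute_env_deriv: "comp_fun_commute (env_deriv a b)"
proof
  fix i j :: 'e
  show "env_deriv a b j \<circ> env_deriv a b i = env_deriv a b i \<circ> env_deriv a b j"
    by (cases "i = j") (auto simp: env_deriv_def set_edge_def fun_eq_iff fun_upd_twist)
qed

lemma env_deriv_set_empty [simp]: "env_deriv_set a b {} \<phi> = \<phi>"
  by (simp add: env_deriv_set_def)

lemma env_deriv_set_insert:
  assumes "finite S" "j \<notin> S"
  shows "env_deriv_set a b (insert j S) \<phi> = env_deriv a b j (env_deriv_set a b S \<phi>)"
proof -
  interpret comp_fun_commute "env_deriv a b"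
    by (rule comp_fun_commute_env_deriv)
  show ?thesis
    using assms by (simp add: env_deriv_set_def)
qed

lemma finite_box_vertices: "finite (box_vertices n :: (int ^ 'd) set)"
proof (rule finite_subset)
  show "(box_vertices n :: (int ^ 'd) set) \<subseteq> vec_lambda ` (UNIV \<rightarrow>\<^sub>E {- 2 * int n .. 2 * int n})"
  proof
    fix x :: "int ^ 'd"
    assume "x \<in> box_vertices n"
    then have "vec_nth x \<in> UNIV \<rightarrow>\<^sub>E {- 2 * int n .. 2 * int n}"
      by (auto simp: box_vertices_def)
    then show "x \<in> vec_lambda ` (UNIV \<rightarrow>\<^sub>E {- 2 * int n .. 2 * int n})"
      by (metis image_eqI vec_nth_inverse)
  qed
  show "finite (vec_lambda ` ((UNIV :: 'd set) \<rightarrow>\<^sub>E {- 2 * int n .. 2 * int n}))"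
    by (intro finite_imageI finite_PiE) auto
qed

lemma finite_box_edges: "finite (box_edges n :: (int ^ 'd) set set)"
  by (rule finite_subset[of _ "Pow (box_vertices n)"])
     (auto simp: box_edges_def finite_box_vertices)

lemma finite_box_paths: "finite (box_paths n x y)"
  by (rule finite_subset[OF _ finite_subset_distinct[OF finite_box_vertices[of n]]])
     (auto simp: box_paths_def)

end

theory Submission
  imports Defs
begin

text \<open>Every derivative of order \<open>k + 1\<close> is a difference of two derivatives of order \<open>k\<close>, and first-order
  derivatives lie in \<open>{0..b - a}\<close>; this gives the upper bounds. For the lower bounds, let two disjoint
  straight segments (arms) of \<open>k\<close> edges lead from the origin to a region in which every edge costs \<open>a\<close>, such
  that the ends of both arms have the same distance to the target, and let every remaining edge cost \<open>b\<close>.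
  A geodesic then follows one of the arms, so the first passage time is a constant plus \<open>b - a\<close> times
  \<open>min B B'\<close>, where \<open>B\<close> and \<open>B'\<close> count the edges of cost \<open>b\<close> on the arms. Fix \<open>B'\<close> and
  differentiate in all edges of the first arm: since the second difference of \<open>i \<mapsto> min i B'\<close> is minus a
  point mass, a signed binomial coefficient results. Moving one of the differentiated edges to the
  second arm flips the sign.\<close>

section \<open>Iterated differences\<close>

text \<open>The \<open>k\<close>-th forward difference at 0: what a derivative in \<open>k\<close>
  edges becomes when the function depends only on how many of these edges cost \<open>b\<close>.
  Shifting \<open>G\<close> instead of moving the base point matches setting one edge to
  \<open>b\<close>.\<close>

fun iter_diff :: "nat \<Rightarrow> (nat \<Rightarrow> real) \<Rightarrow> real" where
  "iter_diff 0 G = G 0"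
| "iter_diff (Suc k) G = iter_diff k (\<lambda>i. G (Suc i)) - iter_diff k G"

lemma iter_diff_diff: "iter_diff k (\<lambda>i. F i - G i) = iter_diff k F - iter_diff k G"
  by (induction k arbitrary: F G) auto

text \<open>The term for \<open>C\<close> is left unevaluated because it vanishes in general only
  from order 1 on.\<close>

lemma iter_diff_scale: "iter_diff k (\<lambda>i. C + c * G i) = iter_diff k (\<lambda>i. C) + c * iter_diff k G"
  by (induction k arbitrary: G) (auto simp: algebra_simps)

lemma iter_diff_const: "iter_diff (Suc k) (\<lambda>i. C) = 0"
  by simp

text \<open>Pascal's rule with alternating signs: shifting the argument moves the point mass from
  \<open>r\<close> to \<open>r - 1\<close>, or removes it if \<open>r = 0\<close>.\<close>

lemma iter_diff_delta:
  "iter_diff k (\<lambda>i. if i = r then 1 else 0) = (- 1) ^ (k + r) * real (k choose r)"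
proof (induction k arbitrary: r)
  case 0
  then show ?case by (cases r) auto
next
  case (Suc k)
  have zero: "iter_diff m (\<lambda>i. 0) = 0" for m by (cases m) auto
  show ?case
    by (cases r) (simp_all add: Suc.IH zero algebra_simps)
qed

text \<open>Raising the cap from \<open>r\<close> to \<open>Suc r\<close> adds the indicator of
  \<open>i > r\<close>. One of the \<open>Suc k\<close> differences turns it into the point mass at
  \<open>r\<close>; the other \<open>k\<close> produce the binomial coefficient.\<close>

lemma iter_diff_min:
  "iter_diff (Suc k) (\<lambda>i. real (min i (Suc r))) - iter_diff (Suc k) (\<lambda>i. real (min i r))
     = (- 1) ^ (k + r) * real (k choose r)"
proof -
  have "iter_diff (Suc k) (\<lambda>i. real (min i (Suc r))) - iter_diff (Suc k) (\<lambda>i. real (min i r))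
    = iter_diff k (\<lambda>i. (real (min (Suc i) (Suc r)) - real (min i (Suc r)))
        - (real (min (Suc i) r) - real (min i r)))"
    by (simp only: iter_diff.simps iter_diff_diff)
  also have "(\<lambda>i. (real (min (Suc i) (Suc r)) - real (min i (Suc r)))
        - (real (min (Suc i) r) - real (min i r))) = (\<lambda>i. if i = r then 1 else 0)"
    by (auto simp: fun_eq_iff min_def)
  finally show ?thesis by (simp only: iter_diff_delta)
qed

text \<open>The derivative evaluates \<open>\<phi>\<close> only at environments that agree with
  \<open>\<omega>\<close> off \<open>S\<close> and take values in \<open>{a, b}\<close> on
  \<open>S\<close>, so the formula is demanded for these alone. Setting an edge to \<open>b\<close>
  raises the count by one and thus shifts \<open>G\<close>; hence both \<open>\<omega>\<close> and
  \<open>G\<close> vary in the induction.\<close>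

lemma env_deriv_set_eq_iter_diff:
  assumes "finite S" and "a \<noteq> b"
    and "\<And>\<omega>'. (\<And>e. e \<notin> S \<Longrightarrow> \<omega>' e = \<omega> e) \<Longrightarrow> \<omega>' ` S \<subseteq> {a, b} \<Longrightarrow>
           \<phi> \<omega>' = G (card {e \<in> S. \<omega>' e = b})"
  shows "env_deriv_set a b S \<phi> \<omega> = iter_diff (card S) G"
  using assms(1,3)
proof (induction S arbitrary: \<omega> G rule: finite_induct)
  case empty
  then show ?case by simp
next
  case (insert j S)
  have "env_deriv_set a b S \<phi> (set_edge j b \<omega>) = iter_diff (card S) (\<lambda>i. G (Suc i))"
  proof (rule insert.IH)
    fix \<omega>' assume 1: "\<And>e. e \<notin> S \<Longrightarrow> \<omega>' e = (set_edge j b \<omega>) e" and 2: "\<omega>' ` S \<subseteq> {a, b}"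
    have j: "\<omega>' j = b" using 1[of j] insert.hyps by (simp add: set_edge_def)
    then have "{e \<in> insert j S. \<omega>' e = b} = insert j {e \<in> S. \<omega>' e = b}" by auto
    then have "card {e \<in> insert j S. \<omega>' e = b} = Suc (card {e \<in> S. \<omega>' e = b})"
      using insert.hyps by simp
    moreover have "\<phi> \<omega>' = G (card {e \<in> insert j S. \<omega>' e = b})"
      using 1 2 j by (intro insert.prems) (auto simp: set_edge_def)
    ultimately show "\<phi> \<omega>' = G (Suc (card {e \<in> S. \<omega>' e = b}))" by simp
  qed
  moreover have "env_deriv_set a b S \<phi> (set_edge j a \<omega>) = iter_diff (card S) G"
  proof (rule insert.IH)
    fix \<omega>' assume 1: "\<And>e. e \<notin> S \<Longrightarrow> \<omega>' e = (set_edge j a \<omega>) e" and 2: "\<omega>' ` S \<subseteq> {a, b}"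
    have j: "\<omega>' j = a" using 1[of j] insert.hyps by (simp add: set_edge_def)
    then have "{e \<in> insert j S. \<omega>' e = b} = {e \<in> S. \<omega>' e = b}" using \<open>a \<noteq> b\<close> by auto
    moreover have "\<phi> \<omega>' = G (card {e \<in> insert j S. \<omega>' e = b})"
      using 1 2 j by (intro insert.prems) (auto simp: set_edge_def)
    ultimately show "\<phi> \<omega>' = G (card {e \<in> S. \<omega>' e = b})" by simp
  qed
  ultimately show ?case
    using insert.hyps by (simp add: env_deriv_set_insert env_deriv_def)
qed

lemma sum_two_valued:
  fixes \<omega> :: "'e \<Rightarrow> real"
  assumes "finite S" "\<omega> ` S \<subseteq> {a, b}" "a \<noteq> b"
  shows "sum \<omega> S = a * real (card S) + (b - a) * real (card {e \<in> S. \<omega> e = b})"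
proof -
  have "sum \<omega> S = (\<Sum>e\<in>S. a + (b - a) * (if \<omega> e = b then 1 else 0))"
    using assms by (intro sum.cong) auto
  also have "\<dots> = a * real (card S) + (b - a) * (\<Sum>e\<in>S. if \<omega> e = b then 1 else 0)"
    by (simp add: sum.distrib sum_distrib_left)
  also have "(\<Sum>e\<in>S. if \<omega> e = b then 1 else 0) = real (card {e \<in> S. \<omega> e = b})"
    using assms(1) by (simp add: sum.If_cases Int_def)
  finally show ?thesis .
qed

section \<open>The lattice distance\<close>

definition l1_dist :: "int ^ 'd \<Rightarrow> int ^ 'd \<Rightarrow> int" where
  "l1_dist x y = (\<Sum>i\<in>UNIV. \<bar>x $ i - y $ i\<bar>)"

lemma adjacent_iff_l1_dist: "adjacent x y \<longleftrightarrow> l1_dist x y = 1"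
  by (simp add: adjacent_def l1_dist_def)

lemma l1_dist_commute: "l1_dist x y = l1_dist y x"
  by (simp add: l1_dist_def abs_minus_commute)

lemma l1_dist_triangle: "l1_dist x z \<le> l1_dist x y + l1_dist y z"
  unfolding l1_dist_def sum.distrib[symmetric] by (rule sum_mono) linarith

lemma l1_dist_nonneg: "0 \<le> l1_dist x y"
  by (simp add: l1_dist_def sum_nonneg)

lemma l1_dist_eq_0_iff: "l1_dist x y = 0 \<longleftrightarrow> x = y"
  by (auto simp: l1_dist_def sum_nonneg_eq_0_iff vec_eq_iff)

lemma box_edgesI:
  "x \<in> box_vertices n \<Longrightarrow> y \<in> box_vertices n \<Longrightarrow> adjacent x y \<Longrightarrow> {x, y} \<in> box_edges n"
  by (auto simp: box_edges_def)

section \<open>Walks and paths\<close>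

lemma passage_time_snoc:
  assumes "p \<noteq> []"
  shows "passage_time \<omega> (p @ [z]) = passage_time \<omega> p + \<omega> {last p, z}"
proof -
  obtain m where m: "length p = Suc m" using assms by (cases p) auto
  have "passage_time \<omega> (p @ [z]) = (\<Sum>i<Suc m. \<omega> {(p @ [z]) ! i, (p @ [z]) ! Suc i})"
    by (simp add: passage_time_def m)
  also have "\<dots> = (\<Sum>i<m. \<omega> {p ! i, p ! Suc i}) + \<omega> {p ! m, z}"
    by (auto simp: nth_append m intro!: sum.cong)
  finally show ?thesis
    using assms by (simp add: passage_time_def m last_conv_nth)
qed

lemma path_edge_in_box_edges:
  assumes "p \<in> box_paths n x y" "i < length p - 1"
  shows "{p ! i, p ! Suc i} \<in> box_edges n"
proof -
  have "adjacent (p ! i) (p ! Suc i)"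
    using assms by (auto simp: box_paths_def successively_conv_nth)
  moreover have "p ! i \<in> set p" "p ! Suc i \<in> set p" using assms(2) by auto
  ultimately show ?thesis using assms by (auto simp: box_paths_def intro!: box_edgesI)
qed

text \<open>Walks, in contrast to \<open>box_paths\<close>, may revisit vertices and can therefore
  be concatenated freely. Only the cost is recorded; with unit edge costs it is the number of
  steps.\<close>

inductive walk_cost :: "(int ^ 'd) set \<Rightarrow> 'd::finite env \<Rightarrow> int ^ 'd \<Rightarrow> int ^ 'd \<Rightarrow> real \<Rightarrow> bool"
  for X :: "(int ^ 'd) set" and \<omega> :: "'d env" and x :: "int ^ 'd"
where
  refl: "x \<in> X \<Longrightarrow> walk_cost X \<omega> x x 0"
| step: "walk_cost X \<omega> x y c \<Longrightarrow> z \<in> X \<Longrightarrow> adjacent y z \<Longrightarrow> walk_cost X \<omega> x z (c + \<omega> {y, z})"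

lemma walk_cost_in: "walk_cost X \<omega> x y c \<Longrightarrow> y \<in> X"
  by (induction rule: walk_cost.induct) auto

lemma walk_cost_trans:
  assumes "walk_cost X \<omega> x y c" and "walk_cost X \<omega> y z c'"
  shows "walk_cost X \<omega> x z (c + c')"
  using assms(2)
proof (induction rule: walk_cost.induct)
  case refl
  then show ?case using assms(1) by simp
next
  case (step y' c' z)
  then show ?case using walk_cost.step[of X \<omega> x y' "c + c'" z] by (simp add: add.assoc)
qed

lemma walk_cost_mono:
  assumes "walk_cost X \<omega> x y c" and "X \<subseteq> Y"
  shows "walk_cost Y \<omega> x y c"
  using assms by (induction rule: walk_cost.induct) (auto intro: walk_cost.intros)

lemma walk_cost_scale:
  assumes "walk_cost X (\<lambda>_. 1) x y c"
    and "\<And>y z. y \<in> X \<Longrightarrow> z \<in> X \<Longrightarrow> adjacent y z \<Longrightarrow> \<omega> {y, z} = a"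
  shows "walk_cost X \<omega> x y (a * c)"
  using assms(1)
proof (induction rule: walk_cost.induct)
  case refl
  then show ?case by (simp add: walk_cost.refl)
next
  case (step y c z)
  have "\<omega> {y, z} = a" using step.hyps walk_cost_in assms(2) by blast
  then show ?case using walk_cost.step[OF step.IH step.hyps(2,3)] by (simp add: algebra_simps)
qed

text \<open>A walk that is monotone in every coordinate has the distance as its length and stays in
  the coordinate box spanned by its endpoints, which the hypothesis places in
  \<open>X\<close>.\<close>

lemma walk_cost_between:
  fixes x y :: "int ^ 'd"
  assumes "\<And>z. (\<And>i. min (x $ i) (y $ i) \<le> z $ i \<and> z $ i \<le> max (x $ i) (y $ i)) \<Longrightarrow> z \<in> X"
  shows "walk_cost X (\<lambda>_. 1) x y (real_of_int (l1_dist x y))"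
  using assms
proof (induction "nat (l1_dist x y)" arbitrary: y)
  case 0
  then have "x = y" using l1_dist_nonneg[of x y] l1_dist_eq_0_iff[of x y] by simp
  then show ?case using 0(2)[of x] by (simp add: l1_dist_def walk_cost.refl)
next
  case (Suc m)
  then have "x \<noteq> y" using l1_dist_eq_0_iff[of x y] by auto
  then obtain i where i: "x $ i \<noteq> y $ i" by (auto simp: vec_eq_iff)
  \<comment> \<open>The vertex visited before \<open>y\<close>: one unit closer to \<open>x\<close>
    in a coordinate where the two differ.\<close>
  define w where "w = (\<chi> k. if k = i then y $ i + sgn (x $ i - y $ i) else y $ k)"
  have w: "w $ i = y $ i + sgn (x $ i - y $ i)" "\<And>k. k \<noteq> i \<Longrightarrow> w $ k = y $ k"
    by (auto simp: w_def)
  have split: "l1_dist u v = \<bar>u $ i - v $ i\<bar> + (\<Sum>k\<in>UNIV - {i}. \<bar>u $ k - v $ k\<bar>)" for u v :: "int ^ 'd"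
    unfolding l1_dist_def by (rule sum.remove) auto
  have xy: "l1_dist x y = l1_dist x w + 1"
    using i by (simp add: split w(1)) (simp add: w(2) sgn_if)
  moreover have "l1_dist w y = 1"
    using i by (simp add: split w(1)) (simp add: w(2) sgn_if)
  moreover have "walk_cost X (\<lambda>_. 1) x w (real_of_int (l1_dist x w))"
  proof (rule Suc.hyps(1))
    show "m = nat (l1_dist x w)" using Suc.hyps(2) xy by linarith
    fix z assume z: "\<And>k. min (x $ k) (w $ k) \<le> z $ k \<and> z $ k \<le> max (x $ k) (w $ k)"
    show "z \<in> X"
    proof (rule Suc.prems)
      fix k
      show "min (x $ k) (y $ k) \<le> z $ k \<and> z $ k \<le> max (x $ k) (y $ k)"
        using z[of k] i w by (cases "k = i") (auto simp: sgn_if split: if_splits)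
    qed
  qed
  moreover have "y \<in> X" by (rule Suc.prems) auto
  ultimately show ?case
    using walk_cost.step[of X "\<lambda>_. 1" x w "real_of_int (l1_dist x w)" y]
    by (simp add: adjacent_iff_l1_dist xy)
qed

text \<open>Loop erasure: when the walk returns to a vertex of the path built so far, the path is
  cut back to that vertex. This cannot raise its cost, as edge costs are nonnegative.\<close>

lemma walk_cost_imp_path:
  assumes "walk_cost (box_vertices n) \<omega> x y c"
    and nonneg: "\<And>e. e \<in> box_edges n \<Longrightarrow> 0 \<le> \<omega> e"
  shows "\<exists>p \<in> box_paths n x y. passage_time \<omega> p \<le> c"
  using assms(1)
proof (induction rule: walk_cost.induct)
  case refl
  then have "[x] \<in> box_paths n x x" by (simp add: box_paths_def)
  then show ?case by (intro bexI[of _ "[x]"]) (simp_all add: passage_time_def)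
next
  case (step y c z)
  then obtain p where p: "p \<in> box_paths n x y" "passage_time \<omega> p \<le> c" by blast
  have y: "y \<in> box_vertices n" using step.hyps walk_cost_in by blast
  then have ez: "0 \<le> \<omega> {y, z}" using step.hyps by (auto intro!: nonneg box_edgesI)
  show ?case
  proof (cases "z \<in> set p")
    case False
    then have "p @ [z] \<in> box_paths n x z"
      using p(1) step.hyps by (auto simp: box_paths_def successively_append_iff)
    moreover have "passage_time \<omega> (p @ [z]) \<le> c + \<omega> {y, z}"
      using p by (subst passage_time_snoc) (auto simp: box_paths_def)
    ultimately show ?thesis by blast
  next
    case True
    then obtain p1 p2 where q: "p = (p1 @ [z]) @ p2" by (metis append.assoc append_Cons append_Nil split_list)
    have "p1 @ [z] \<in> box_paths n x z"
    proof -
      have "successively adjacent (p1 @ [z])"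
        using p(1) successively_append_iff[of adjacent "p1 @ [z]" p2]
        unfolding box_paths_def q by blast
      moreover have "hd (p1 @ [z]) = x"
        using p(1) unfolding box_paths_def q by (cases p1) auto
      ultimately show ?thesis using p(1) unfolding q by (auto simp: box_paths_def)
    qed
    moreover have "passage_time \<omega> (p1 @ [z]) \<le> passage_time \<omega> p"
    proof -
      have "passage_time \<omega> (p1 @ [z]) = (\<Sum>i<length p1. \<omega> {p ! i, p ! Suc i})"
        unfolding passage_time_def q by (auto simp: nth_append intro!: sum.cong)
      also have "\<dots> \<le> passage_time \<omega> p"
        unfolding passage_time_def
        using path_edge_in_box_edges[OF p(1)] by (intro sum_mono2) (auto simp: q intro!: nonneg)
      finally show ?thesis .
    qed
    ultimately show ?thesis using p(2) ez by force
  qed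
qed

lemma box_vertices_between:
  assumes "x \<in> box_vertices n" "y \<in> box_vertices n"
    and z: "\<And>i. min (x $ i) (y $ i) \<le> z $ i \<and> z $ i \<le> max (x $ i) (y $ i)"
  shows "z \<in> box_vertices n"
  unfolding box_vertices_def
proof (intro CollectI allI)
  fix i
  show "- 2 * int n \<le> z $ i \<and> z $ i \<le> 2 * int n"
    using z[of i] assms(1,2) unfolding box_vertices_def
    by (auto simp: min_def max_def split: if_splits dest!: spec[of _ i])
qed

lemma box_paths_nonempty:
  assumes "x \<in> box_vertices n" "y \<in> box_vertices n"
  shows "box_paths n x y \<noteq> {}"
proof -
  have "walk_cost (box_vertices n) (\<lambda>_. 1) x y (real_of_int (l1_dist x y))"
    by (rule walk_cost_between, rule box_vertices_between[OF assms])
  from walk_cost_imp_path[OF this] show ?thesis by auto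
qed

lemma zero_in_box_vertices: "0 \<in> box_vertices n"
  by (simp add: box_vertices_def)

lemma first_passage_time_le:
  assumes "walk_cost (box_vertices n) \<omega> 0 (int n *s v) c"
    and "\<And>e. e \<in> box_edges n \<Longrightarrow> 0 \<le> \<omega> e"
  shows "first_passage_time v n \<omega> \<le> c"
proof -
  obtain p where "p \<in> box_paths n 0 (int n *s v)" "passage_time \<omega> p \<le> c"
    using walk_cost_imp_path[OF assms] by blast
  then show ?thesis
    unfolding first_passage_time_def
    by (intro order.trans[OF Min_le]) (auto simp: finite_box_paths)
qed


section \<open>First-order derivatives\<close>

text \<open>A path with distinct vertices uses the edge \<open>j\<close> at most once, so changing
  the cost of \<open>j\<close> from \<open>a\<close> to \<open>b\<close> adds either 0 or
  \<open>b - a\<close>.\<close>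

lemma passage_time_set_edge_bounds:
  assumes p: "p \<in> box_paths n x y" and ab: "a \<le> b"
  shows "passage_time (set_edge j a \<omega>) p \<le> passage_time (set_edge j b \<omega>) p"
    and "passage_time (set_edge j b \<omega>) p \<le> passage_time (set_edge j a \<omega>) p + (b - a)"
proof -
  define I where "I = {i. i < length p - 1 \<and> {p ! i, p ! Suc i} = j}"
  have "finite I" by (simp add: I_def)
  have "i = i'" if "i \<in> I" "i' \<in> I" for i i'
  proof -
    have lt: "Suc i < length p" "Suc i' < length p" and eq: "{p ! i, p ! Suc i} = {p ! i', p ! Suc i'}"
      using that by (auto simp: I_def)
    have nth_eq: "p ! k = p ! l \<longleftrightarrow> k = l" if "k < length p" "l < length p" for k l
      using p that by (simp add: box_paths_def nth_eq_iff_index_eq)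
    \<comment> \<open>The second alternative, one edge traversed in both directions, would force
      \<open>i = Suc i'\<close> and \<open>Suc i = i'\<close>.\<close>
    from eq have "(p ! i = p ! i' \<and> p ! Suc i = p ! Suc i') \<or> (p ! i = p ! Suc i' \<and> p ! Suc i = p ! i')"
      by (simp add: doubleton_eq_iff)
    then show ?thesis using lt by (auto simp: nth_eq)
  qed
  then have "card I \<le> 1" by (metis \<open>finite I\<close> card_le_Suc0_iff_eq One_nat_def)
  have "passage_time (set_edge j b \<omega>) p - passage_time (set_edge j a \<omega>) p
      = (\<Sum>i<length p - 1. if {p ! i, p ! Suc i} = j then b - a else 0)"
    unfolding passage_time_def sum_subtractf[symmetric]
    by (rule sum.cong) (auto simp: set_edge_def)
  also have "\<dots> = (\<Sum>i\<in>I. b - a)"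
    by (rule sum.mono_neutral_cong_right) (auto simp: I_def)
  also have "\<dots> = real (card I) * (b - a)" by simp
  finally have eq: "passage_time (set_edge j b \<omega>) p - passage_time (set_edge j a \<omega>) p
      = real (card I) * (b - a)" .
  have "real (card I) * (b - a) \<le> 1 * (b - a)"
    using ab \<open>card I \<le> 1\<close> by (intro mult_right_mono) auto
  moreover have "0 \<le> real (card I) * (b - a)" using ab by simp
  ultimately show "passage_time (set_edge j a \<omega>) p \<le> passage_time (set_edge j b \<omega>) p"
    and "passage_time (set_edge j b \<omega>) p \<le> passage_time (set_edge j a \<omega>) p + (b - a)"
    using eq by simp_all
qed

text \<open>Each bound compares the minimum on its left with the path that is optimal for the
  environment on its right, and then uses the bound for this single path.\<close>

lemma first_passage_time_set_edge_bounds: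
  assumes "int n *s v \<in> box_vertices n" and ab: "a \<le> b"
  shows "first_passage_time v n (set_edge j a \<omega>) \<le> first_passage_time v n (set_edge j b \<omega>)"
    and "first_passage_time v n (set_edge j b \<omega>) \<le> first_passage_time v n (set_edge j a \<omega>) + (b - a)"
proof -
  let ?P = "box_paths n 0 (int n *s v)"
  have ne: "?P \<noteq> {}" using assms zero_in_box_vertices by (intro box_paths_nonempty)
  have attained: "\<exists>p\<in>?P. first_passage_time v n \<omega>' = passage_time \<omega>' p" for \<omega>'
    using Min_in[of "passage_time \<omega>' ` ?P"] ne finite_box_paths[of n 0 "int n *s v"]
    unfolding first_passage_time_def by blast
  have le: "first_passage_time v n \<omega>' \<le> passage_time \<omega>' p" if "p \<in> ?P" for \<omega>' p
    using that finite_box_paths by (auto simp: first_passage_time_def intro!: Min_le)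
  obtain p where p: "p \<in> ?P" "first_passage_time v n (set_edge j b \<omega>) = passage_time (set_edge j b \<omega>) p"
    using attained by blast
  then show "first_passage_time v n (set_edge j a \<omega>) \<le> first_passage_time v n (set_edge j b \<omega>)"
    using le[OF p(1)] passage_time_set_edge_bounds(1)[OF p(1) ab] by (metis order.trans)
  obtain q where q: "q \<in> ?P" "first_passage_time v n (set_edge j a \<omega>) = passage_time (set_edge j a \<omega>) q"
    using attained by blast
  then show "first_passage_time v n (set_edge j b \<omega>) \<le> first_passage_time v n (set_edge j a \<omega>) + (b - a)"
    using le[OF q(1)] passage_time_set_edge_bounds(2)[OF q(1) ab] by (metis order.trans)
qed

section \<open>The recursive upper bounds\<close>

lemma set_edge_in_environments:
  "\<omega> \<in> environments a b n \<Longrightarrow> j \<in> box_edges n \<Longrightarrow> \<delta> \<in> {a, b} \<Longrightarrow> set_edge j \<delta> \<omega> \<in> environments a b n"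
  unfolding environments_def set_edge_def
  by (rule PiE_I) (auto dest: PiE_mem PiE_arb)

text \<open>Differentiating last in one chosen edge \<open>j\<close> of \<open>S\<close> leaves two
  derivatives in \<open>T\<close>, evaluated at environments that differ at most in
  \<open>j\<close>.\<close>

lemma deriv_values_Suc:
  assumes "x \<in> deriv_values a b v (Suc k)"
  shows "\<exists>y\<in>deriv_values a b v k. \<exists>z\<in>deriv_values a b v k. x = y - z"
proof -
  obtain n S \<omega> where x: "x = env_deriv_set a b S (first_passage_time v n) \<omega>"
    and S: "S \<subseteq> box_edges n" "card S = Suc k" and \<omega>: "\<omega> \<in> environments a b n"
    using assms by (auto simp: deriv_values_def)
  obtain j T where T: "S = insert j T" "j \<notin> T" "card T = k" "finite T"
    using S(2) by (metis card_Suc_eq_finite)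
  have mem: "env_deriv_set a b T (first_passage_time v n) (set_edge j \<delta> \<omega>) \<in> deriv_values a b v k"
    if "\<delta> \<in> {a, b}" for \<delta>
    using S T \<omega> that unfolding deriv_values_def by (fastforce intro: set_edge_in_environments)
  show ?thesis
    using mem[of b] mem[of a] T unfolding x by (auto simp: env_deriv_set_insert env_deriv_def)
qed

lemma deriv_values_1:
  assumes "a \<le> b" and "\<forall>n. int n *s v \<in> box_vertices n"
  shows "deriv_values a b v 1 \<subseteq> {0..b - a}"
proof
  fix x assume "x \<in> deriv_values a b v 1"
  then obtain n j \<omega> where "x = env_deriv_set a b {j} (first_passage_time v n) \<omega>"
    by (auto simp: deriv_values_def card_1_singleton_iff)
  then have "x = first_passage_time v n (set_edge j b \<omega>) - first_passage_time v n (set_edge j a \<omega>)"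
    using env_deriv_set_insert[of "{}" j a b] by (simp add: env_deriv_def)
  moreover have "int n *s v \<in> box_vertices n" using assms(2) by blast
  ultimately show "x \<in> {0..b - a}"
    using first_passage_time_set_edge_bounds[OF _ assms(1), of n v j \<omega>] by auto
qed

text \<open>Each further order at most doubles the bound. The induction starts at order 2, because a
  difference of two numbers in \<open>{0..b - a}\<close> is at most \<open>b - a\<close> in absolute
  value, so this one step costs no factor of 2.\<close>

lemma deriv_values_bounded:
  assumes "a \<le> b" and "\<forall>n. int n *s v \<in> box_vertices n" and "k \<ge> 2" and "x \<in> deriv_values a b v k"
  shows "\<bar>x\<bar> \<le> 2 ^ (k - 2) * (b - a)"
  using assms(3,4)
proof (induction k arbitrary: x rule: dec_induct)
  case base
  then obtain y z where "y \<in> deriv_values a b v 1" "z \<in> deriv_values a b v 1" "x = y - z"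
    using deriv_values_Suc[of x a b v 1] by (auto simp: numeral_2_eq_2)
  then have "y \<in> {0..b - a}" "z \<in> {0..b - a}" using deriv_values_1[OF assms(1,2)] by blast+
  then show ?case using \<open>x = y - z\<close> by auto
next
  case (step k)
  then obtain y z where yz: "y \<in> deriv_values a b v k" "z \<in> deriv_values a b v k" "x = y - z"
    using deriv_values_Suc by blast
  have "\<bar>x\<bar> \<le> 2 * (2 ^ (k - 2) * (b - a))"
    using step.IH[OF yz(1)] step.IH[OF yz(2)] yz(3) by linarith
  also have "\<dots> = 2 ^ (Suc k - 2) * (b - a)" by (metis Suc_diff_le mult.assoc power_Suc step.hyps(1))
  finally show ?case .
qed

lemma bounded_deriv_values:
  assumes "a \<le> b" and "\<forall>n. int n *s v \<in> box_vertices n" and "k \<ge> 1"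
  shows "bdd_above (deriv_values a b v k)" "bdd_below (deriv_values a b v k)"
proof -
  have "\<exists>B. \<forall>x\<in>deriv_values a b v k. \<bar>x\<bar> \<le> B"
  proof (cases "k = 1")
    case True
    then show ?thesis using deriv_values_1[OF assms(1,2)] by (intro exI[of _ "b - a"]) force
  next
    case False
    then show ?thesis using deriv_values_bounded[OF assms(1,2)] assms(3)
      by (intro exI[of _ "2 ^ (k - 2) * (b - a)"]) auto
  qed
  then obtain B where B: "\<And>x. x \<in> deriv_values a b v k \<Longrightarrow> \<bar>x\<bar> \<le> B" by blast
  show "bdd_above (deriv_values a b v k)"
    using B by (intro bdd_aboveI[of _ B]) force
  show "bdd_below (deriv_values a b v k)"
    using B by (intro bdd_belowI[of _ "- B"]) force
qed

section \<open>Two arms leading to a cheap region\<close>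

text \<open>A certificate for lower bounds on passage times: a set \<open>C\<close> of pairs (vertex, lower bound) that is
  \<open>b\<close>-Lipschitz for the lattice distance. Pairs instead of a function spare a proof that the
  descriptions of the bounds on the two arms and on the region agree where these meet.\<close>

lemma passage_time_ge_certificate:
  fixes C :: "((int ^ 'd) \<times> real) set"
  assumes lip: "\<And>x y c d. (x, c) \<in> C \<Longrightarrow> (y, d) \<in> C \<Longrightarrow> c \<le> d + b * real_of_int (l1_dist x y)"
    and edge: "\<And>x y. x \<in> box_vertices n \<Longrightarrow> y \<in> box_vertices n \<Longrightarrow> adjacent x y \<Longrightarrow> \<omega> {x, y} < b \<Longrightarrow>
      \<exists>c d. (x, c) \<in> C \<and> (y, d) \<in> C \<and> d \<le> c + \<omega> {x, y}"
    and "0 \<le> b" and "(x, 0) \<in> C" and "(y, c) \<in> C" and "p \<in> box_paths n x y"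
  shows "c \<le> passage_time \<omega> p"
proof -
  \<comment> \<open>The last vertex of a prefix of the path need not occur in \<open>C\<close>. The
    induction therefore proves the bound that every certified pair \<open>(u, c)\<close> imposes on
    all other vertices through the Lipschitz condition.\<close>
  have "c \<le> passage_time \<omega> p + b * real_of_int (l1_dist u (last p))"
    if "p \<noteq> []" "hd p = x" "set p \<subseteq> box_vertices n" "successively adjacent p" "(u, c) \<in> C" for p u c
    using that
  proof (induction p arbitrary: u c rule: rev_nonempty_induct)
    case (single z)
    then show ?case using lip[OF _ assms(4)] by (simp add: passage_time_def)
  next
    case (snoc z p)
    define y where "y = last p"
    have adj: "adjacent y z" and p: "hd p = x" "set p \<subseteq> box_vertices n" "successively adjacent p"
      using snoc by (auto simp: successively_append_iff y_def)
    have box: "y \<in> box_vertices n" "z \<in> box_vertices n"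
      using snoc p by (auto simp: y_def subset_iff)
    have pt: "passage_time \<omega> (p @ [z]) = passage_time \<omega> p + \<omega> {y, z}"
      using snoc.hyps by (simp add: passage_time_snoc y_def)
    note IH = snoc.IH[OF p, folded y_def]
    show ?case
    proof (cases "\<omega> {y, z} < b")
      case True
      then obtain c1 c2 where c12: "(y, c1) \<in> C" "(z, c2) \<in> C" "c2 \<le> c1 + \<omega> {y, z}"
        using edge[OF box adj] by blast
      have "l1_dist y y = 0" by (simp add: l1_dist_eq_0_iff)
      then have "c1 \<le> passage_time \<omega> p" using IH[OF c12(1)] by simp
      then show ?thesis using lip[OF snoc.prems(4) c12(2)] c12(3) by (simp add: pt)
    next
      \<comment> \<open>An edge of cost at least \<open>b\<close> is paid for by the Lipschitz term:
        crossing it changes the distance to \<open>u\<close> by at most 1.\<close>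
      case False
      have "l1_dist u y \<le> l1_dist u z + 1"
        using l1_dist_triangle[of u y z] adj by (simp add: adjacent_iff_l1_dist l1_dist_commute)
      then have "b * real_of_int (l1_dist u y) \<le> b * (real_of_int (l1_dist u z) + 1)"
        using \<open>0 \<le> b\<close> by (intro mult_left_mono) auto
      then show ?thesis using IH[OF snoc.prems(4)] False by (simp add: pt algebra_simps)
    qed
  qed
  from this[of p y c] show ?thesis
    using assms(5,6) l1_dist_eq_0_iff[of y y] by (auto simp: box_paths_def)
qed


text \<open>Each arm has \<open>M\<close> edges, and from the end of either arm the target is
  reached in \<open>l\<close> steps inside \<open>R\<close>. The assumptions
  \<open>region_far\<close> and \<open>region_near\<close> are tailored to the Lipschitz condition
  of the certificate between a vertex of an arm and a vertex of \<open>R\<close>, one for each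
  direction. In this form they cover opposite as well as perpendicular arms.\<close>

locale two_arms =
  fixes a b :: real and n M :: nat and v :: "int ^ 'd"
    and arm :: "bool \<Rightarrow> nat \<Rightarrow> int ^ 'd" and R :: "(int ^ 'd) set" and l :: int
  assumes ab: "0 < a" "a < b"
    and arm_0: "arm s 0 = 0"
    and arm_dist_same: "l1_dist (arm s i) (arm s j) = \<bar>int i - int j\<bar>"
    and arm_dist_other: "s \<noteq> s' \<Longrightarrow> l1_dist (arm s i) (arm s' j) = int i + int j"
    and arm_box: "j \<le> M \<Longrightarrow> arm s j \<in> box_vertices n"
    and arm_notin_region: "j < M \<Longrightarrow> arm s j \<notin> R"
    and target_in_region: "int n *s v \<in> R"
    and region_walk: "walk_cost (R \<inter> box_vertices n) (\<lambda>_. 1) (arm s M) (int n *s v) (real_of_int l)"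
    and region_far: "w \<in> R \<Longrightarrow> j \<le> M \<Longrightarrow>
      b * (real M - real j) + a * real_of_int (l - l1_dist w (int n *s v)) \<le> b * real_of_int (l1_dist w (arm s j))"
    and region_near: "w \<in> R \<Longrightarrow> j \<le> M \<Longrightarrow> l1_dist w (int n *s v) - l \<le> l1_dist w (arm s j)"
begin

section \<open>Admissible environments and arm costs\<close>

definition arm_edge :: "bool \<Rightarrow> nat \<Rightarrow> (int ^ 'd) set" where
  "arm_edge s j = {arm s j, arm s (Suc j)}"

definition arm_cost :: "'d env \<Rightarrow> bool \<Rightarrow> nat \<Rightarrow> real" where
  "arm_cost \<omega> s j = (\<Sum>i<j. \<omega> (arm_edge s i))"

text \<open>Only the costs on the arms are left free. An edge with just one endpoint in
  \<open>R\<close> counts as outside and is expensive, unless it belongs to an arm.\<close>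

definition admissible :: "'d env \<Rightarrow> bool" where
  "admissible \<omega> \<longleftrightarrow> \<omega> \<in> environments a b n \<and>
     (\<forall>e\<in>box_edges n. e \<subseteq> R \<longrightarrow> \<omega> e = a) \<and>
     (\<forall>e\<in>box_edges n. \<not> e \<subseteq> R \<longrightarrow> (\<forall>s. e \<notin> arm_edge s ` {..<M}) \<longrightarrow> \<omega> e = b)"

lemma arm_eq_iff: "arm s i = arm s' j \<longleftrightarrow> i = j \<and> (s = s' \<or> i = 0)"
  using arm_dist_same[of s i j] arm_dist_other[of s s' i j] l1_dist_eq_0_iff[of "arm s i" "arm s' j"]
  by (cases "s = s'") auto

lemma arm_edge_eq_iff: "arm_edge s i = arm_edge s' j \<longleftrightarrow> s = s' \<and> i = j"
  unfolding arm_edge_def doubleton_eq_iff arm_eq_iff by auto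

lemma adjacent_arm: "adjacent (arm s j) (arm s (Suc j))"
  by (simp add: adjacent_iff_l1_dist arm_dist_same)

lemma arm_edge_in_box: "j < M \<Longrightarrow> arm_edge s j \<in> box_edges n"
  unfolding arm_edge_def by (intro box_edgesI arm_box adjacent_arm) auto

lemma arm_edge_not_in_region: "j < M \<Longrightarrow> \<not> arm_edge s j \<subseteq> R"
  using arm_notin_region by (auto simp: arm_edge_def)

lemma admissible_cost: "admissible \<omega> \<Longrightarrow> e \<in> box_edges n \<Longrightarrow> \<omega> e \<in> {a, b}"
  by (auto simp: admissible_def environments_def dest: PiE_mem)

lemma arm_cost_diff:
  assumes "admissible \<omega>" "i \<le> j" "j \<le> M"
  shows "0 \<le> arm_cost \<omega> s j - arm_cost \<omega> s i"
    and "arm_cost \<omega> s j - arm_cost \<omega> s i \<le> b * (real j - real i)"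
proof -
  have eq: "arm_cost \<omega> s j - arm_cost \<omega> s i = (\<Sum>k=i..<j. \<omega> (arm_edge s k))"
    using assms(2) unfolding arm_cost_def lessThan_atLeast0 by (simp add: sum_diff_nat_ivl)
  have mem: "\<omega> (arm_edge s k) \<in> {a, b}" if "k \<in> {i..<j}" for k
    using that assms by (intro admissible_cost arm_edge_in_box) auto
  show "0 \<le> arm_cost \<omega> s j - arm_cost \<omega> s i"
    unfolding eq using mem ab by (intro sum_nonneg) force
  have "(\<Sum>k=i..<j. \<omega> (arm_edge s k)) \<le> (\<Sum>k=i..<j. b)"
    using mem ab by (intro sum_mono) force
  also have "\<dots> = b * (real j - real i)" using assms(2) by (simp add: of_nat_diff)
  finally show "arm_cost \<omega> s j - arm_cost \<omega> s i \<le> b * (real j - real i)" unfolding eq .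
qed

section \<open>The certificate and the first passage time of two arms\<close>

definition cheapest_arm :: "'d env \<Rightarrow> real" where
  "cheapest_arm \<omega> = min (arm_cost \<omega> True M) (arm_cost \<omega> False M)"

lemma cheapest_arm_le: "cheapest_arm \<omega> \<le> arm_cost \<omega> s M"
  by (cases s) (auto simp: cheapest_arm_def)

text \<open>On the region the bound is counted backwards from the target, where it equals the
  claimed passage time. On an arm it is capped by \<open>cheapest_arm \<omega>\<close>, because a
  path may also enter the arm from its far end after using the other arm.\<close>

definition arm_certificate :: "'d env \<Rightarrow> ((int ^ 'd) \<times> real) set" where
  "arm_certificate \<omega> =
     {(arm s j, min (arm_cost \<omega> s j) (cheapest_arm \<omega>)) | s j. j \<le> M} \<union>
     {(w, cheapest_arm \<omega> + a * real_of_int (l - l1_dist w (int n *s v))) | w. w \<in> R}"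

text \<open>Along one arm, costs change by at most \<open>b\<close> per edge. Between different arms
  the route through the origin has length \<open>i + j\<close>, which alone pays for
  \<open>c\<close>. Inside \<open>R\<close> the triangle inequality gives even the constant
  \<open>a\<close>. The mixed cases rest on \<open>region_near\<close> and
  \<open>region_far\<close>.\<close>

lemma arm_certificate_lipschitz:
  assumes adm: "admissible \<omega>" and x: "(x, c) \<in> arm_certificate \<omega>" and y: "(y, d) \<in> arm_certificate \<omega>"
  shows "c \<le> d + b * real_of_int (l1_dist x y)"
proof -
  define D where "D = cheapest_arm \<omega>"
  have cost0: "arm_cost \<omega> s 0 = 0" for s by (simp add: arm_cost_def)
  have cost_nonneg: "0 \<le> arm_cost \<omega> s j" if "j \<le> M" for s j
    using arm_cost_diff(1)[OF adm _ that, of 0 s] cost0 by simp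
  have "0 \<le> D" using cost_nonneg[of M] by (simp add: D_def cheapest_arm_def)
  consider
    (arms) s i s' j where "x = arm s i" "c = min (arm_cost \<omega> s i) D" "i \<le> M"
      "y = arm s' j" "d = min (arm_cost \<omega> s' j) D" "j \<le> M"
  | (arm_region) s i where "x = arm s i" "c = min (arm_cost \<omega> s i) D" "i \<le> M"
      "y \<in> R" "d = D + a * real_of_int (l - l1_dist y (int n *s v))"
  | (region_arm) s j where "y = arm s j" "d = min (arm_cost \<omega> s j) D" "j \<le> M"
      "x \<in> R" "c = D + a * real_of_int (l - l1_dist x (int n *s v))"
  | (regions) "x \<in> R" "c = D + a * real_of_int (l - l1_dist x (int n *s v))"
      "y \<in> R" "d = D + a * real_of_int (l - l1_dist y (int n *s v))"
    using x y unfolding arm_certificate_def D_def[symmetric] by blast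
  then show ?thesis
  proof cases
    case arms
    show ?thesis
    proof (cases "s = s'")
      case True
      have "arm_cost \<omega> s i - arm_cost \<omega> s j \<le> b * real_of_int \<bar>int i - int j\<bar>"
      proof (cases "j \<le> i")
        case True
        then show ?thesis using arm_cost_diff(2)[OF adm True \<open>i \<le> M\<close>, of s] by simp
      next
        case False
        then have "0 \<le> b * real_of_int \<bar>int i - int j\<bar>" using ab by simp
        then show ?thesis using arm_cost_diff(1)[OF adm _ \<open>j \<le> M\<close>, of i s] False by simp
      qed
      moreover have "l1_dist x y = \<bar>int i - int j\<bar>" using arms True by (simp only: arm_dist_same)
      moreover have "0 \<le> b * real_of_int \<bar>int i - int j\<bar>" using ab by simp
      ultimately show ?thesis using arms True by (auto simp: min_def)
    next
      case False
      have "c \<le> b * real i"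
        using arms arm_cost_diff(2)[OF adm _ \<open>i \<le> M\<close>, of 0 s] cost0 by simp
      moreover have "0 \<le> d" using arms \<open>0 \<le> D\<close> cost_nonneg by simp
      moreover have "l1_dist x y = int i + int j" using arms arm_dist_other[OF False] by simp
      moreover have "0 \<le> b * real j" using ab by simp
      ultimately show ?thesis by (simp add: algebra_simps)
    qed
  next
    case arm_region
    \<comment> \<open>The cap gives \<open>c \<le> D\<close>, so only the distance term of
      \<open>d\<close> has to be compensated.\<close>
    have near: "l1_dist y (int n *s v) - l \<le> l1_dist x y"
      using region_near[of y i s] arm_region by (simp add: l1_dist_commute)
    have "a * real_of_int (l1_dist y (int n *s v) - l) \<le> a * real_of_int (l1_dist x y)"
      using near ab by (intro mult_left_mono) auto
    also have "\<dots> \<le> b * real_of_int (l1_dist x y)"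
      using ab l1_dist_nonneg[of x y] by (intro mult_right_mono) auto
    finally show ?thesis using arm_region by (simp add: algebra_simps)
  next
    case region_arm
    have "0 \<le> b * (real M - real j)" using ab region_arm by simp
    \<comment> \<open>If the cap is active, then \<open>d = D\<close>; otherwise
      \<open>M - j\<close> edges of the arm lead from \<open>d\<close> to a value that is at least
      \<open>D\<close>.\<close>
    then have "D - d \<le> b * (real M - real j)"
      using region_arm arm_cost_diff(2)[OF adm \<open>j \<le> M\<close>, of s] cheapest_arm_le[of \<omega> s]
      by (auto simp: D_def min_def)
    then show ?thesis
      using region_far[of x j s] region_arm by simp
  next
    case regions
    have "l1_dist y (int n *s v) - l1_dist x (int n *s v) \<le> l1_dist x y"
      using l1_dist_triangle[of y "int n *s v" x] by (simp add: l1_dist_commute)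
    then have "a * real_of_int (l1_dist y (int n *s v) - l1_dist x (int n *s v)) \<le> a * real_of_int (l1_dist x y)"
      using ab by (intro mult_left_mono) auto
    also have "\<dots> \<le> b * real_of_int (l1_dist x y)"
      using ab l1_dist_nonneg[of x y] by (intro mult_right_mono) auto
    finally show ?thesis using regions by (simp add: algebra_simps)
  qed
qed

text \<open>By admissibility, an edge cheaper than \<open>b\<close> costs \<open>a\<close> and lies
  in \<open>R\<close> or on an arm. In \<open>R\<close> the distance to the target changes by at
  most 1 across it; on an arm the cost changes by exactly \<open>a\<close>, and capping does not
  enlarge this difference, in either orientation.\<close>

lemma arm_certificate_edge:
  assumes adm: "admissible \<omega>" and box: "x \<in> box_vertices n" "y \<in> box_vertices n" and adj: "adjacent x y"
    and "\<omega> {x, y} < b"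
  shows "\<exists>c d. (x, c) \<in> arm_certificate \<omega> \<and> (y, d) \<in> arm_certificate \<omega> \<and> d \<le> c + \<omega> {x, y}"
proof -
  have e: "{x, y} \<in> box_edges n" using box adj by (rule box_edgesI)
  then have a: "\<omega> {x, y} = a" using admissible_cost[OF adm e] assms(5) by auto
  show ?thesis
  proof (cases "{x, y} \<subseteq> R")
    case True
    have "l1_dist x (int n *s v) - l1_dist y (int n *s v) \<le> 1"
      using l1_dist_triangle[of x "int n *s v" y] adj by (simp add: adjacent_iff_l1_dist)
    then have "a * real_of_int (l1_dist x (int n *s v) - l1_dist y (int n *s v)) \<le> a * 1"
      using ab by (intro mult_left_mono) auto
    then show ?thesis
      using True unfolding arm_certificate_def a
      by (intro exI[of _ "cheapest_arm \<omega> + a * real_of_int (l - l1_dist x (int n *s v))"]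
          exI[of _ "cheapest_arm \<omega> + a * real_of_int (l - l1_dist y (int n *s v))"])
        (auto simp: algebra_simps)
  next
    case False
    then obtain s j where j: "j < M" "{x, y} = arm_edge s j"
      using adm e assms(5) by (force simp: admissible_def)
    define f where "f i = min (arm_cost \<omega> s i) (cheapest_arm \<omega>)" for i
    have mem: "(arm s i, f i) \<in> arm_certificate \<omega>" if "i \<le> M" for i
      using that by (auto simp: arm_certificate_def f_def)
    have "arm_cost \<omega> s (Suc j) = arm_cost \<omega> s j + a"
      using a j by (simp add: arm_cost_def)
    then have "f (Suc j) \<le> f j + a" "f j \<le> f (Suc j) + a"
      using ab by (auto simp: f_def min_def)
    moreover have "(x = arm s j \<and> y = arm s (Suc j)) \<or> (x = arm s (Suc j) \<and> y = arm s j)"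
      using j by (auto simp: arm_edge_def doubleton_eq_iff)
    ultimately show ?thesis using mem[of j] mem[of "Suc j"] j(1) a by auto
  qed
qed

text \<open>Following an arm and then the walk through \<open>R\<close> gives the upper bound, once
  for each arm. The certificate contains the origin with value 0 and the target with the claimed
  value, which gives the lower bound.\<close>

lemma first_passage_time_two_arms:
  assumes adm: "admissible \<omega>"
  shows "first_passage_time v n \<omega> = a * real_of_int l + min (arm_cost \<omega> True M) (arm_cost \<omega> False M)"
proof (rule antisym)
  have nonneg: "0 \<le> \<omega> e" if "e \<in> box_edges n" for e
    using admissible_cost[OF adm that] ab by auto
  have le: "first_passage_time v n \<omega> \<le> arm_cost \<omega> s M + a * real_of_int l" for s
  proof (rule first_passage_time_le[OF _ nonneg], rule walk_cost_trans)
    have "walk_cost (box_vertices n) \<omega> 0 (arm s j) (arm_cost \<omega> s j)" if "j \<le> M" for j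
      using that
    proof (induction j)
      case 0
      then show ?case by (simp add: arm_0 arm_cost_def walk_cost.refl[OF zero_in_box_vertices])
    next
      case (Suc j)
      then show ?case
        using walk_cost.step[OF _ arm_box[OF Suc.prems, of s] adjacent_arm, of \<omega> 0 "arm_cost \<omega> s j"]
        by (simp add: arm_cost_def arm_edge_def)
    qed
    then show "walk_cost (box_vertices n) \<omega> 0 (arm s M) (arm_cost \<omega> s M)" by simp
    have "walk_cost (R \<inter> box_vertices n) \<omega> (arm s M) (int n *s v) (a * real_of_int l)"
      using adm by (intro walk_cost_scale[OF region_walk]) (auto simp: admissible_def box_edgesI)
    then show "walk_cost (box_vertices n) \<omega> (arm s M) (int n *s v) (a * real_of_int l)"
      by (rule walk_cost_mono) auto
  qed
  show "first_passage_time v n \<omega> \<le> a * real_of_int l + min (arm_cost \<omega> True M) (arm_cost \<omega> False M)"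
    using le[of True] le[of False] by (simp add: min_def add.commute)
  have "int n *s v \<in> box_vertices n" using walk_cost_in[OF region_walk] by blast
  then have "box_paths n 0 (int n *s v) \<noteq> {}"
    using zero_in_box_vertices by (intro box_paths_nonempty)
  moreover have "a * real_of_int l + min (arm_cost \<omega> True M) (arm_cost \<omega> False M) \<le> passage_time \<omega> p"
    if "p \<in> box_paths n 0 (int n *s v)" for p
  proof (rule passage_time_ge_certificate[OF arm_certificate_lipschitz[OF adm] arm_certificate_edge[OF adm] _ _ _ that])
    have cost0: "arm_cost \<omega> s 0 = 0" for s by (simp add: arm_cost_def)
    have "0 \<le> arm_cost \<omega> s M" for s using arm_cost_diff(1)[OF adm, of 0 M s] cost0 by simp
    then have "min (arm_cost \<omega> True 0) (cheapest_arm \<omega>) = 0" by (simp add: cheapest_arm_def cost0)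
    moreover have "(arm True 0, min (arm_cost \<omega> True 0) (cheapest_arm \<omega>)) \<in> arm_certificate \<omega>"
      unfolding arm_certificate_def by blast
    ultimately show "(0, 0) \<in> arm_certificate \<omega>" by (simp add: arm_0)
    have "l1_dist (int n *s v) (int n *s v) = 0" by (simp add: l1_dist_eq_0_iff)
    then show "(int n *s v, a * real_of_int l + min (arm_cost \<omega> True M) (arm_cost \<omega> False M)) \<in> arm_certificate \<omega>"
      using target_in_region unfolding arm_certificate_def cheapest_arm_def by (auto simp: add.commute)
  qed (use ab in auto)
  ultimately show "a * real_of_int l + min (arm_cost \<omega> True M) (arm_cost \<omega> False M) \<le> first_passage_time v n \<omega>"
    unfolding first_passage_time_def by (subst Min_ge_iff) (auto simp: finite_box_paths)
qed

text \<open>\<open>S\<close> consists of the first \<open>m + 1\<close> edges of the arm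
  \<open>True\<close>, and the last edge \<open>e0\<close> is taken from the arm \<open>s\<close>.
  Differentiating in \<open>S\<close> gives iterated differences of a capped count; differentiating
  in \<open>e0\<close> compares the caps \<open>r\<close> and \<open>Suc r\<close>, with a sign that
  depends on \<open>s\<close>.\<close>

lemma deriv_value_two_arms:
  assumes M: "M = Suc (Suc m)" and "r \<le> m"
  shows "(if s then - 1 else 1) * ((b - a) * ((- 1) ^ (m + r) * real (m choose r))) \<in> deriv_values a b v M"
proof -
  \<comment> \<open>The number of expensive edges on the arm \<open>False\<close>, not counting
    \<open>e0\<close>. With this choice the caps \<open>r\<close> and \<open>Suc r\<close> result in
    both cases: if \<open>s\<close> holds, setting \<open>e0\<close> to \<open>b\<close> turns
    \<open>min i (Suc r)\<close> into \<open>1 + min i r\<close>.\<close>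
  define r' where "r' = (if s then Suc r else r)"
  define e0 where "e0 = arm_edge s (Suc m)"
  define S where "S = arm_edge True ` {..<Suc m}"
  \<comment> \<open>The values at \<open>e0\<close> and on \<open>S\<close> are overwritten by the
    differentiation. Outside the box edges, \<open>undefined\<close> is forced by the extensional
    function space.\<close>
  define \<omega> where "\<omega> e = (if e \<notin> box_edges n then undefined
    else if e \<subseteq> R \<or> e \<in> arm_edge True ` {..<M} \<or> e \<in> arm_edge False ` {r'..<M} then a else b)" for e
  have inj: "inj_on (arm_edge True) X" for X by (auto simp: inj_on_def arm_edge_eq_iff)
  have S: "finite S" "card S = Suc m" "e0 \<notin> S" "insert e0 S \<subseteq> box_edges n"
    using arm_edge_in_box by (auto simp: S_def e0_def M card_image[OF inj] arm_edge_eq_iff)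
  have \<omega>: "\<omega> \<in> environments a b n"
    by (auto simp: environments_def \<omega>_def)
  have deriv_eq: "env_deriv_set a b S (first_passage_time v n) (set_edge e0 \<delta> \<omega>) =
      (b - a) * iter_diff (Suc m) (\<lambda>i. real (min (if s \<and> \<delta> = b then Suc i else i)
        (if \<not> s \<and> \<delta> = b then Suc r' else r')))" (is "_ = (b - a) * iter_diff _ ?G")
    if \<delta>: "\<delta> \<in> {a, b}" for \<delta>
  proof -
    \<comment> \<open>The passage time when all arm edges cost \<open>a\<close>.\<close>
    define C where "C = a * real_of_int l + a * real M"
    have "env_deriv_set a b S (first_passage_time v n) (set_edge e0 \<delta> \<omega>) =
      iter_diff (card S) (\<lambda>i. C + (b - a) * ?G i)"
    proof (rule env_deriv_set_eq_iter_diff[OF S(1)])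
      show "a \<noteq> b" using ab by simp
      fix \<omega>' assume off: "\<And>e. e \<notin> S \<Longrightarrow> \<omega>' e = set_edge e0 \<delta> \<omega> e" and on: "\<omega>' ` S \<subseteq> {a, b}"
      have vals: "\<omega>' e = (if e = e0 then \<delta> else \<omega> e)" if "e \<notin> S" for e
        using off[OF that] by (simp add: set_edge_def)
      have adm: "admissible \<omega>'"
        unfolding admissible_def
      proof (intro conjI ballI impI)
        show "\<omega>' \<in> environments a b n"
          unfolding environments_def
        proof (rule PiE_I)
          fix e :: "(int ^ 'd) set" assume e: "e \<in> box_edges n"
          show "\<omega>' e \<in> {a, b}"
            using on vals[of e] \<delta> e by (cases "e \<in> S") (auto simp: \<omega>_def)
        next
          fix e :: "(int ^ 'd) set" assume e: "e \<notin> (box_edges n :: (int ^ 'd) set set)"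
          then have "e \<noteq> e0" "e \<notin> S" using S(4) by auto
          then show "\<omega>' e = undefined" using vals e by (simp add: \<omega>_def)
        qed
      next
        fix e :: "(int ^ 'd) set" assume e: "e \<in> box_edges n" "e \<subseteq> R"
        then have "e \<noteq> e0" "e \<notin> S"
          using arm_edge_not_in_region by (auto simp: e0_def S_def M)
        then show "\<omega>' e = a" using vals e by (simp add: \<omega>_def)
      next
        fix e :: "(int ^ 'd) set" assume e: "e \<in> box_edges n" "\<not> e \<subseteq> R" "\<forall>s. e \<notin> arm_edge s ` {..<M}"
        then have "e \<noteq> e0" "e \<notin> S" by (force simp: e0_def S_def M)+
        moreover have "e \<notin> arm_edge False ` {r'..<M}" using e(3) by force
        ultimately show "\<omega>' e = b" using vals e by (simp add: \<omega>_def)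
      qed
      have S_sum: "(\<Sum>i<Suc m. \<omega>' (arm_edge True i)) =
          a * real (Suc m) + (b - a) * real (card {e \<in> S. \<omega>' e = b})"
        using sum_two_valued[OF S(1) on \<open>a \<noteq> b\<close>] sum.reindex[OF inj, of \<omega>' "{..<Suc m}"]
        by (simp add: S(2) S_def[symmetric] del: sum.lessThan_Suc)
      have last_True: "\<omega>' (arm_edge True (Suc m)) = (if s then \<delta> else a)"
      proof -
        have "arm_edge True (Suc m) \<notin> S" by (auto simp: S_def arm_edge_eq_iff)
        moreover have "\<omega> (arm_edge True (Suc m)) = a"
          using arm_edge_in_box by (auto simp: \<omega>_def M)
        ultimately show ?thesis using vals by (simp add: e0_def arm_edge_eq_iff)
      qed
      have False_edge: "\<omega>' (arm_edge False i) = (if \<not> s \<and> i = Suc m then \<delta> else if i < r' then b else a)"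
        if "i < M" for i
      proof -
        have "arm_edge False i \<notin> S" by (auto simp: S_def arm_edge_eq_iff)
        moreover have "\<omega> (arm_edge False i) = (if i < r' then b else a)"
          using arm_edge_in_box[OF that] arm_edge_not_in_region[OF that] that
          by (auto simp: \<omega>_def arm_edge_eq_iff image_iff)
        ultimately show ?thesis using vals by (auto simp: e0_def arm_edge_eq_iff)
      qed
      have r': "r' \<le> Suc m" using \<open>r \<le> m\<close> by (simp add: r'_def)
      have "(\<Sum>i<Suc m. \<omega>' (arm_edge False i)) = (\<Sum>i<Suc m. a + (b - a) * (if i < r' then 1 else 0))"
        by (rule sum.cong) (auto simp: False_edge M)
      also have "\<dots> = a * real (Suc m) + (b - a) * (\<Sum>i<Suc m. if i < r' then 1 else 0)"
        unfolding sum.distrib sum_distrib_left by simp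
      also have "(\<Sum>i<Suc m. if i < r' then 1 else 0) = real (card {i \<in> {..<Suc m}. i < r'})"
        by (simp add: sum.If_cases Int_def del: sum.lessThan_Suc)
      also have "{i \<in> {..<Suc m}. i < r'} = {..<r'}" using r' by auto
      finally have False_sum: "(\<Sum>i<Suc m. \<omega>' (arm_edge False i)) = a * real (Suc m) + (b - a) * real r'"
        by simp
      have last_False: "\<omega>' (arm_edge False (Suc m)) = (if s then a else \<delta>)"
        using False_edge[of "Suc m"] r' by (auto simp: M)
      let ?N = "card {e \<in> S. \<omega>' e = b}"
      have cost_True: "arm_cost \<omega>' True M = a * real M + (b - a) * real (if s \<and> \<delta> = b then Suc ?N else ?N)"
        unfolding arm_cost_def M sum.lessThan_Suc[of _ "Suc m"] S_sum last_True
        using \<delta> \<open>a \<noteq> b\<close> by (auto simp: algebra_simps)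
      have cost_False: "arm_cost \<omega>' False M = a * real M + (b - a) * real (if \<not> s \<and> \<delta> = b then Suc r' else r')"
        unfolding arm_cost_def M sum.lessThan_Suc[of _ "Suc m"] False_sum last_False
        using \<delta> \<open>a \<noteq> b\<close> by (auto simp: algebra_simps)
      have "min (arm_cost \<omega>' True M) (arm_cost \<omega>' False M) = a * real M + (b - a) * ?G ?N"
        unfolding cost_True cost_False using ab
        by (simp only: min_add_distrib_right[symmetric] of_nat_min min_mult_distrib_left) simp
      then show "first_passage_time v n \<omega>' = C + (b - a) * ?G ?N"
        using first_passage_time_two_arms[OF adm] by (simp add: C_def)
    qed
    \<comment> \<open>The constant \<open>C\<close> drops out because at least one difference is
      taken.\<close>
    then show ?thesis by (simp only: S(2) iter_diff_scale iter_diff_const)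
  qed
  have eq: "env_deriv_set a b (insert e0 S) (first_passage_time v n) \<omega> =
      (if s then - 1 else 1) * ((b - a) * ((- 1) ^ (m + r) * real (m choose r)))"
  proof -
    let ?D = "\<lambda>\<delta>. env_deriv_set a b S (first_passage_time v n) (set_edge e0 \<delta> \<omega>)"
    have D: "env_deriv_set a b (insert e0 S) (first_passage_time v n) \<omega> = ?D b - ?D a"
      by (simp add: env_deriv_set_insert[OF S(1,3)] env_deriv_def)
    have "b \<noteq> a" using ab by simp
    show ?thesis
    proof (cases s)
      case True
      have "?D b = (b - a) * iter_diff (Suc m) (\<lambda>i. real (min (Suc i) (Suc r)))"
        using deriv_eq[of b] by (simp only: r'_def True if_True simp_thms insert_iff if_False)
      also have "(\<lambda>i. real (min (Suc i) (Suc r))) = (\<lambda>i. 1 + 1 * real (min i r))"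
        by (auto simp: fun_eq_iff)
      also have "iter_diff (Suc m) (\<lambda>i. 1 + 1 * real (min i r)) = iter_diff (Suc m) (\<lambda>i. real (min i r))"
        unfolding iter_diff_scale iter_diff_const by (simp only: mult_1 add_0)
      finally have Db: "?D b = (b - a) * iter_diff (Suc m) (\<lambda>i. real (min i r))" .
      have Da: "?D a = (b - a) * iter_diff (Suc m) (\<lambda>i. real (min i (Suc r)))"
        using deriv_eq[of a] \<open>b \<noteq> a\<close>[symmetric]
        by (simp only: r'_def True if_True simp_thms insert_iff if_False)
      have "?D b - ?D a = - ((b - a) * ((- 1) ^ (m + r) * real (m choose r)))"
        unfolding Da Db iter_diff_min[of m r, symmetric] right_diff_distrib by simp
      then show ?thesis unfolding D using True by simp
    next
      case False
      have Db: "?D b = (b - a) * iter_diff (Suc m) (\<lambda>i. real (min i (Suc r)))"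
        using deriv_eq[of b] False by (simp only: r'_def if_True simp_thms insert_iff if_False)
      have Da: "?D a = (b - a) * iter_diff (Suc m) (\<lambda>i. real (min i r))"
        using deriv_eq[of a] False \<open>b \<noteq> a\<close>[symmetric]
        by (simp only: r'_def if_True simp_thms insert_iff if_False)
      have "?D b - ?D a = (b - a) * ((- 1) ^ (m + r) * real (m choose r))"
        unfolding Da Db iter_diff_min[of m r, symmetric] right_diff_distrib by simp
      then show ?thesis unfolding D using False by simp
    qed
  qed
  have "card (insert e0 S) = M" using S by (simp add: M)
  then show ?thesis
    using S(4) \<omega> unfolding deriv_values_def eq[symmetric]
    by (intro CollectI exI[of _ n] exI[of _ "insert e0 S"] exI[of _ \<omega>]) simp
qed

text \<open>The parity of \<open>M - 2 + r\<close> fixes the sign of the computed derivative up to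
  the choice of the arm for the last edge; the two choices realise both signs.\<close>

lemma binomial_in_deriv_values:
  assumes "M \<ge> 2" and "r \<le> M - 2"
  shows "(b - a) * real ((M - 2) choose r) \<in> deriv_values a b v M"
    and "- ((b - a) * real ((M - 2) choose r)) \<in> deriv_values a b v M"
proof -
  have "M = Suc (Suc (M - 2))" using assms by simp
  note val = deriv_value_two_arms[OF this assms(2)]
  show "(b - a) * real ((M - 2) choose r) \<in> deriv_values a b v M"
    using val[of "odd (M - 2 + r)"] by (cases "odd (M - 2 + r)") simp_all
  show "- ((b - a) * real ((M - 2) choose r)) \<in> deriv_values a b v M"
    using val[of "even (M - 2 + r)"] by (cases "odd (M - 2 + r)") simp_all
qed

end

section \<open>Arms and regions in the lattice\<close>

lemma l1_dist_split:
  fixes x y :: "int ^ 'd"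
  assumes "i1 \<noteq> i2"
  shows "l1_dist x y = \<bar>x $ i1 - y $ i1\<bar> + \<bar>x $ i2 - y $ i2\<bar> + (\<Sum>i\<in>UNIV - {i1, i2}. \<bar>x $ i - y $ i\<bar>)"
proof -
  have "(\<Sum>i\<in>UNIV - {i1}. \<bar>x $ i - y $ i\<bar>) = \<bar>x $ i2 - y $ i2\<bar> + (\<Sum>i\<in>UNIV - {i1} - {i2}. \<bar>x $ i - y $ i\<bar>)"
    using assms by (intro sum.remove) auto
  moreover have "UNIV - {i1} - {i2} = UNIV - {i1, i2}" by auto
  moreover have "l1_dist x y = \<bar>x $ i1 - y $ i1\<bar> + (\<Sum>i\<in>UNIV - {i1}. \<bar>x $ i - y $ i\<bar>)"
    unfolding l1_dist_def by (rule sum.remove) auto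
  ultimately show ?thesis by simp
qed

text \<open>If \<open>d\<close> is nonnegative, \<open>a\<close> may be replaced by
  \<open>b\<close>; otherwise the term with \<open>d\<close> only helps. This lets
  \<open>region_far\<close> follow from two inequalities between integers.\<close>

lemma weighted_le:
  fixes a b :: real and A B d :: int
  assumes "0 < a" "a < b" "A \<le> B" "A + d \<le> B"
  shows "b * real_of_int A + a * real_of_int d \<le> b * real_of_int B"
proof (cases "d \<ge> 0")
  case True
  have "a * real_of_int d \<le> b * real_of_int d" using assms True by (intro mult_right_mono) auto
  moreover have "b * real_of_int (A + d) \<le> b * real_of_int B" using assms by (intro mult_left_mono) auto
  ultimately show ?thesis by (simp add: algebra_simps)
next
  case False
  then have "a * real_of_int d \<le> 0" using assms by (simp add: mult_nonneg_nonpos)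
  moreover have "b * real_of_int A \<le> b * real_of_int B" using assms by (intro mult_left_mono) auto
  ultimately show ?thesis by linarith
qed

text \<open>If \<open>v\<close> vanishes in some direction, the arms point in the two opposite directions of that axis.
  They can be avoided only by travelling in a straight line through expensive edges, which does not pay
  off when \<open>n\<close> is large.\<close>

lemma two_arms_opposite:
  fixes v :: "int ^ 'd"
  assumes ab: "0 < a" "a < b" and ne: "i1 \<noteq> i2" and v: "v $ i1 \<noteq> 0" "v $ i2 = 0"
    and box: "int n *s v \<in> box_vertices n" and M: "M \<le> n"
    and large: "(a + b) * real M \<le> (b - a) * real n"
  shows "two_arms a b n M v (\<lambda>s j. axis i2 (if s then int j else - int j))
    {w. int M \<le> \<bar>w $ i2\<bar> \<or> int n * \<bar>v $ i1\<bar> \<le> sgn (v $ i1) * w $ i1}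
    (int M + l1_dist 0 (int n *s v))"
proof -
  define t where "t = int n *s v"
  \<comment> \<open>Three half-spaces: two begin at the ends of the arms, and the third, bounded by
    the hyperplane through the target orthogonal to the axis \<open>i1\<close>, joins them.\<close>
  define R where "R = {w :: int ^ 'd. int M \<le> \<bar>w $ i2\<bar> \<or> int n * \<bar>v $ i1\<bar> \<le> sgn (v $ i1) * w $ i1}"
  define arm :: "bool \<Rightarrow> nat \<Rightarrow> int ^ 'd" where "arm s j = axis i2 (if s then int j else - int j)" for s j
  define rest where "rest x y = (\<Sum>i\<in>UNIV - {i1, i2}. \<bar>x $ i - y $ i\<bar>)" for x y :: "int ^ 'd"
  define N where "N = int n * \<bar>v $ i1\<bar>"
  note split = l1_dist_split[OF ne, folded rest_def]
  have t1: "\<bar>t $ i1\<bar> = N" and t2: "t $ i2 = 0"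
    using v by (auto simp: t_def N_def abs_mult)
  have t1': "sgn (v $ i1) * t $ i1 = N" by (simp add: t_def N_def abs_sgn mult.left_commute mult.commute)
  have "int n * 1 \<le> int n * \<bar>v $ i1\<bar>" using v by (intro mult_left_mono) auto
  then have nN: "int n \<le> N" by (simp add: N_def)
  have arm1: "arm s j $ i1 = 0" and arm2: "arm s j $ i2 = (if s then int j else - int j)" for s j
    using ne by (auto simp: arm_def axis_def)
  have rest_arm: "rest w (arm s j) = rest w 0" for w s j
    unfolding rest_def by (rule sum.cong) (auto simp: arm_def axis_def)
  have rest_arms: "rest (arm s i) (arm s' j) = 0" for s i s' j
    unfolding rest_def by (rule sum.neutral) (auto simp: arm_def axis_def)
  have rest_nonneg: "0 \<le> rest x y" for x y by (simp add: rest_def sum_nonneg)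
  have rest_triangle: "rest x z \<le> rest x y + rest y z" for x y z
    unfolding rest_def sum.distrib[symmetric] by (rule sum_mono) linarith
  have rest_commute: "rest x y = rest y x" for x y
    by (simp add: rest_def abs_minus_commute)
  have dist_t: "l1_dist w t = \<bar>w $ i1 - t $ i1\<bar> + \<bar>w $ i2\<bar> + rest w t" for w
    by (simp add: split t2)
  have dist_arm: "l1_dist w (arm s j) = \<bar>w $ i1\<bar> + \<bar>w $ i2 - (if s then int j else - int j)\<bar> + rest w 0" for w s j
    by (simp add: split arm1 arm2 rest_arm)
  have l: "l1_dist 0 t = N + rest 0 t" by (simp add: split t1 t2)
  have arm_box: "arm s j \<in> box_vertices n" if "j \<le> M" for s j
    using that M by (auto simp: box_vertices_def arm_def axis_def)
  have "two_arms a b n M v arm R (int M + l1_dist 0 t)"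
  proof (unfold_locales, fold t_def)
    show "arm s 0 = 0" for s by (simp add: arm_def)
    show "l1_dist (arm s i) (arm s j) = \<bar>int i - int j\<bar>" for s i j
      by (simp add: split arm1 arm2 rest_arms abs_minus_commute)
    show "l1_dist (arm s i) (arm s' j) = int i + int j" if "s \<noteq> s'" for s s' i j
      using that by (auto simp: split arm1 arm2 rest_arms)
    show "arm s j \<in> box_vertices n" if "j \<le> M" for s j by (rule arm_box[OF that])
    show "arm s j \<notin> R" if "j < M" for s j
      using that nN M unfolding R_def N_def[symmetric] by (simp add: arm1 arm2)
    show "t \<in> R" by (simp add: R_def N_def[symmetric] t1')
    show "walk_cost (R \<inter> box_vertices n) (\<lambda>_. 1) (arm s M) t (real_of_int (int M + l1_dist 0 t))" for s
    proof -
      \<comment> \<open>The corner of the route: from the end of the arm parallel to the axis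
        \<open>i1\<close> up to the hyperplane of the target, then inside this hyperplane. Both legs
        stay in \<open>R\<close>.\<close>
      define u where "u = arm s M + axis i1 (t $ i1)"
      have u: "u $ i1 = t $ i1" "u $ i2 = arm s M $ i2" "\<And>i. i \<noteq> i1 \<Longrightarrow> i \<noteq> i2 \<Longrightarrow> u $ i = 0"
        using ne by (auto simp: u_def arm_def axis_def)
      have u_box: "u \<in> box_vertices n"
        unfolding box_vertices_def
      proof (intro CollectI allI)
        fix i
        show "- 2 * int n \<le> u $ i \<and> u $ i \<le> 2 * int n"
          using u(1,2) u(3)[of i] box arm_box[OF order.refl, of s] unfolding t_def[symmetric] box_vertices_def
          by (cases "i = i1"; cases "i = i2") (auto dest!: spec[of _ i])
      qed
      have walk1: "walk_cost (R \<inter> box_vertices n) (\<lambda>_. 1) (arm s M) u (real_of_int (l1_dist (arm s M) u))"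
      proof (rule walk_cost_between)
        fix z assume z: "\<And>i. min (arm s M $ i) (u $ i) \<le> z $ i \<and> z $ i \<le> max (arm s M $ i) (u $ i)"
        have "z $ i2 = arm s M $ i2" using z[of i2] u(2) by auto
        then have "z \<in> R" by (simp add: R_def arm2)
        then show "z \<in> R \<inter> box_vertices n"
          using box_vertices_between[OF arm_box[OF order.refl] u_box z] by blast
      qed
      have walk2: "walk_cost (R \<inter> box_vertices n) (\<lambda>_. 1) u t (real_of_int (l1_dist u t))"
      proof (rule walk_cost_between)
        fix z assume z: "\<And>i. min (u $ i) (t $ i) \<le> z $ i \<and> z $ i \<le> max (u $ i) (t $ i)"
        have "z $ i1 = t $ i1" using z[of i1] u(1) by auto
        then have "z \<in> R" by (simp add: R_def t1' N_def[symmetric])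
        then show "z \<in> R \<inter> box_vertices n"
          using box_vertices_between[OF u_box _ z] box by (simp add: t_def)
      qed
      have dist: "l1_dist (arm s M) u + l1_dist u t = int M + l1_dist 0 t"
      proof -
        have "rest (arm s M) u = 0" "rest u t = rest 0 t"
          unfolding rest_def by (auto simp: u arm_def axis_def intro!: sum.neutral sum.cong)
        then show ?thesis by (simp add: split u t2 arm1 arm2)
      qed
      show ?thesis
        using walk_cost_trans[OF walk1 walk2] by (simp only: of_int_add[symmetric] dist)
    qed
    show "l1_dist w t - (int M + l1_dist 0 t) \<le> l1_dist w (arm s j)" if "w \<in> R" "j \<le> M" for w j s
      using that(2) rest_triangle[of w t 0] t1 unfolding dist_t dist_arm l by (cases s) auto
    show "b * (real M - real j) + a * real_of_int (int M + l1_dist 0 t - l1_dist w t)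
        \<le> b * real_of_int (l1_dist w (arm s j))" if w: "w \<in> R" and j: "j \<le> M" for w j s
    proof (cases "int M \<le> \<bar>w $ i2\<bar>")
      case True
      have "int M - int j \<le> l1_dist w (arm s j)"
        using True rest_nonneg[of w 0] unfolding dist_arm by (cases s) auto
      moreover have "int M - int j + (int M + l1_dist 0 t - l1_dist w t) \<le> l1_dist w (arm s j)"
        using True rest_triangle[of 0 t w] rest_commute[of 0 w] t1 unfolding dist_arm dist_t l by (cases s) auto
      ultimately show ?thesis using weighted_le[OF ab, of "int M - int j" "l1_dist w (arm s j)"] by (metis of_int_diff of_int_of_nat_eq)
    next
      \<comment> \<open>Here \<open>w\<close> lies in the third half-space only, at distance at
        least \<open>N + rest w 0\<close> from the arms. As \<open>n \<le> N\<close>, the assumption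
        \<open>large\<close> makes \<open>b * N\<close> exceed or equal
        \<open>b * M + a * (M + N)\<close>.\<close>
      case False
      then have w1: "N \<le> sgn (v $ i1) * w $ i1" using w by (simp add: R_def N_def)
      have "N \<le> \<bar>w $ i1\<bar>" using w1 by (auto simp: sgn_if split: if_splits)
      have "N - \<bar>w $ i1 - t $ i1\<bar> \<le> N" by simp
      then have "int M + l1_dist 0 t - l1_dist w t \<le> int M + N + rest w 0"
        using rest_triangle[of 0 t w] rest_commute[of 0 w] t1 unfolding dist_t l by simp
      then have "a * real_of_int (int M + l1_dist 0 t - l1_dist w t) \<le> a * real_of_int (int M + N + rest w 0)"
        using ab by (intro mult_left_mono) auto
      moreover have "b * real_of_int (N + rest w 0) \<le> b * real_of_int (l1_dist w (arm s j))"
        using ab \<open>N \<le> \<bar>w $ i1\<bar>\<close> unfolding dist_arm by (intro mult_left_mono) auto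
      moreover have "a * real_of_int (rest w 0) \<le> b * real_of_int (rest w 0)"
        using ab rest_nonneg[of w 0] by (intro mult_right_mono) auto
      moreover have "(b - a) * real n \<le> (b - a) * real_of_int N"
        using ab nN by (intro mult_left_mono) auto
      moreover have "b * (real M - real j) \<le> b * real M" using ab by (intro mult_left_mono) auto
      ultimately show ?thesis using large by (simp add: algebra_simps)
    qed
  qed (use ab in auto)
  then show ?thesis by (simp only: arm_def[abs_def] R_def t_def)
qed

text \<open>Both arms point towards the target along different axes, and each begins a shortest
  lattice walk to it, so the remaining distance is the same for both. The region starts where one of
  the two oriented coordinates reaches \<open>M\<close>.\<close>

lemma two_arms_perpendicular:
  fixes v :: "int ^ 'd"
  assumes ab: "0 < a" "a < b" and ne: "i1 \<noteq> i2" and v: "v $ i1 \<noteq> 0" "v $ i2 \<noteq> 0"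
    and box: "int n *s v \<in> box_vertices n" and M: "M \<le> n"
  shows "two_arms a b n M v
    (\<lambda>s j. if s then axis i1 (sgn (v $ i1) * int j) else axis i2 (sgn (v $ i2) * int j))
    {w. int M \<le> sgn (v $ i1) * w $ i1 \<or> int M \<le> sgn (v $ i2) * w $ i2}
    (l1_dist 0 (int n *s v) - int M)"
proof -
  define t where "t = int n *s v"
  \<comment> \<open>Coordinates oriented by the signs of \<open>v\<close>, so that those of the
    target are nonnegative.\<close>
  define x y where "x w = sgn (v $ i1) * w $ i1" and "y w = sgn (v $ i2) * w $ i2" for w :: "int ^ 'd"
  define R where "R = {w :: int ^ 'd. int M \<le> x w \<or> int M \<le> y w}"
  define arm :: "bool \<Rightarrow> nat \<Rightarrow> int ^ 'd" where
    "arm s j = (if s then axis i1 (sgn (v $ i1) * int j) else axis i2 (sgn (v $ i2) * int j))" for s j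
  define rest where "rest x y = (\<Sum>i\<in>UNIV - {i1, i2}. \<bar>x $ i - y $ i\<bar>)" for x y :: "int ^ 'd"
  have sgn: "sgn (v $ i1) = 1 \<or> sgn (v $ i1) = - 1" "sgn (v $ i2) = 1 \<or> sgn (v $ i2) = - 1"
    using v by (auto simp: sgn_if)
  have split: "l1_dist w w' = \<bar>x w - x w'\<bar> + \<bar>y w - y w'\<bar> + rest w w'" for w w'
    using sgn by (auto simp: l1_dist_split[OF ne] rest_def x_def y_def)
  have "int n * 1 \<le> int n * \<bar>v $ i1\<bar>" "int n * 1 \<le> int n * \<bar>v $ i2\<bar>"
    using v by (intro mult_left_mono; simp)+
  then have t: "int M \<le> x t" "int M \<le> y t"
    using M by (auto simp: x_def y_def t_def abs_sgn mult.left_commute mult.commute)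
  have xy0: "x 0 = 0" "y 0 = 0" by (auto simp: x_def y_def)
  have x_arm: "x (arm s j) = (if s then int j else 0)" and y_arm: "y (arm s j) = (if s then 0 else int j)" for s j
    using ne sgn by (auto simp: arm_def axis_def x_def y_def)
  have rest_arm: "rest w (arm s j) = rest w 0" for w s j
    unfolding rest_def by (rule sum.cong) (auto simp: arm_def axis_def)
  have rest_arms: "rest (arm s i) (arm s' j) = 0" for s i s' j
    unfolding rest_def by (rule sum.neutral) (auto simp: arm_def axis_def)
  have rest_nonneg: "0 \<le> rest x y" for x y by (simp add: rest_def sum_nonneg)
  have rest_triangle: "rest x z \<le> rest x y + rest y z" for x y z
    unfolding rest_def sum.distrib[symmetric] by (rule sum_mono) linarith
  have rest_commute: "rest x y = rest y x" for x y
    by (simp add: rest_def abs_minus_commute)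
  have dist_arm: "l1_dist w (arm s j) = \<bar>x w - (if s then int j else 0)\<bar> + \<bar>y w - (if s then 0 else int j)\<bar> + rest w 0"
    for w s j by (simp add: split x_arm y_arm rest_arm)
  have l: "l1_dist 0 t = x t + y t + rest 0 t" using t by (simp add: split xy0)
  have arm_box: "arm s j \<in> box_vertices n" if "j \<le> M" for s j
    using that M sgn by (auto simp: box_vertices_def arm_def axis_def)
  have "two_arms a b n M v arm R (l1_dist 0 t - int M)"
  proof (unfold_locales, fold t_def)
    show "arm s 0 = 0" for s by (simp add: arm_def)
    show "l1_dist (arm s i) (arm s j) = \<bar>int i - int j\<bar>" for s i j
      by (simp add: split x_arm y_arm rest_arms)
    show "l1_dist (arm s i) (arm s' j) = int i + int j" if "s \<noteq> s'" for s s' i j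
      using that by (auto simp: split x_arm y_arm rest_arms)
    show "arm s j \<in> box_vertices n" if "j \<le> M" for s j by (rule arm_box[OF that])
    show "arm s j \<notin> R" if "j < M" for s j
      using that by (simp add: R_def x_arm y_arm)
    show "t \<in> R" using t by (simp add: R_def)
    show "walk_cost (R \<inter> box_vertices n) (\<lambda>_. 1) (arm s M) t (real_of_int (l1_dist 0 t - int M))" for s
    proof -
      \<comment> \<open>One monotone walk suffices: the oriented coordinate that equals
        \<open>M\<close> at the end of the arm never falls below \<open>M\<close> on the way to the
        target.\<close>
      have "walk_cost (R \<inter> box_vertices n) (\<lambda>_. 1) (arm s M) t (real_of_int (l1_dist (arm s M) t))"
      proof (rule walk_cost_between)
        fix z assume z: "\<And>i. min (arm s M $ i) (t $ i) \<le> z $ i \<and> z $ i \<le> max (arm s M $ i) (t $ i)"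
        have "int M \<le> x z" if s
          using z[of i1] t(1) x_arm[of s M] that sgn(1) by (auto simp: x_def min_def max_def split: if_splits)
        moreover have "int M \<le> y z" if "\<not> s"
          using z[of i2] t(2) y_arm[of s M] that sgn(2) by (auto simp: y_def min_def max_def split: if_splits)
        ultimately have "z \<in> R" by (auto simp: R_def)
        then show "z \<in> R \<inter> box_vertices n"
          using box_vertices_between[OF arm_box[OF order.refl] _ z] box by (simp add: t_def)
      qed
      moreover have "l1_dist (arm s M) t = l1_dist 0 t - int M"
        using t dist_arm[of t s M] rest_commute[of 0 t] unfolding l by (simp add: l1_dist_commute)
      ultimately show ?thesis by simp
    qed
    show "l1_dist w t - (l1_dist 0 t - int M) \<le> l1_dist w (arm s j)" if "w \<in> R" "j \<le> M" for w j s
      using that rest_triangle[of w t 0] t unfolding dist_arm l split[of w t] R_def by (cases s) auto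
    show "b * (real M - real j) + a * real_of_int (l1_dist 0 t - int M - l1_dist w t)
        \<le> b * real_of_int (l1_dist w (arm s j))" if w: "w \<in> R" and j: "j \<le> M" for w j s
    proof -
      have "int M - int j \<le> l1_dist w (arm s j)"
        using w j rest_nonneg[of w 0] unfolding dist_arm R_def by (cases s) auto
      moreover have "int M - int j + (l1_dist 0 t - int M - l1_dist w t) \<le> l1_dist w (arm s j)"
        using w j rest_triangle[of 0 t w] rest_commute[of 0 w] t
        unfolding dist_arm l split[of w t] R_def by (cases s) auto
      ultimately show ?thesis using weighted_le[OF ab, of "int M - int j" "l1_dist w (arm s j)"] by (metis of_int_diff of_int_of_nat_eq)
    qed
  qed (use ab in auto)
  then show ?thesis by (simp only: arm_def[abs_def] R_def t_def x_def y_def)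
qed

text \<open>Besides a direction \<open>i1\<close> in which \<open>v\<close> does not vanish there is
  a second direction \<open>i2\<close>, the dimension being at least 2. The arms are opposite if
  \<open>v $ i2 = 0\<close> and perpendicular otherwise.\<close>

lemma binomials_in_deriv_values:
  fixes v :: "int ^ 'd"
  assumes "CARD('d) \<ge> 2" and ab: "0 < a" "a < b" and "v \<noteq> 0" and box: "\<forall>n. int n *s v \<in> box_vertices n"
    and k: "k \<ge> 2" "r \<le> k - 2"
  shows "(b - a) * real ((k - 2) choose r) \<in> deriv_values a b v k \<and>
    - ((b - a) * real ((k - 2) choose r)) \<in> deriv_values a b v k"
proof -
  obtain i1 where i1: "v $ i1 \<noteq> 0" using \<open>v \<noteq> 0\<close> by (auto simp: vec_eq_iff)
  have "\<not> (UNIV :: 'd set) \<subseteq> {i1}" using assms(1) card_mono[of "{i1}" "UNIV :: 'd set"] by auto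
  then obtain i2 where "i2 \<notin> {i1}" by (meson subsetI)
  then have i2: "i1 \<noteq> i2" by simp
  \<comment> \<open>The first entry makes arms of \<open>k\<close> edges fit into the box; the
    second makes the straight route that avoids two opposite arms unprofitable.\<close>
  define n where "n = max k (nat \<lceil>(a + b) * real k / (b - a)\<rceil>)"
  have "k \<le> n" by (simp add: n_def)
  have "(a + b) * real k / (b - a) \<le> real n" unfolding n_def by linarith
  then have "(a + b) * real k \<le> (b - a) * real n" using ab by (simp add: field_simps)
  then obtain arm R l where "two_arms a b n k v arm R l"
    using two_arms_opposite[OF ab i2 i1 _ _ \<open>k \<le> n\<close>] two_arms_perpendicular[OF ab i2 i1 _ _ \<open>k \<le> n\<close>] box
    by (cases "v $ i2 = 0") blast+
  then interpret two_arms a b n k v arm R l .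
  show ?thesis using binomial_in_deriv_values[OF k] by blast
qed

section \<open>Recursion, upper bounds and binomial lower bounds for the extremal
  derivatives\<close>

theorem theorem1p3:
  fixes a b :: real and v :: "int ^ 'd"
  assumes "CARD('d) \<ge> 2"
    and "0 < a" and "a < b"
    and "v \<noteq> 0" and "\<forall>n. int n *s v \<in> box_vertices n"
  shows "(\<forall>k\<ge>1. sup_deriv a b v (k + 1) \<le> sup_deriv a b v k - inf_deriv a b v k \<and>
                 inf_deriv a b v (k + 1) \<ge> inf_deriv a b v k - sup_deriv a b v k) \<and>
         (\<forall>k\<ge>2. sup_deriv a b v k \<le> 2 ^ (k - 2) \<and> \<bar>inf_deriv a b v k\<bar> \<le> 2 ^ (k - 2)) \<and>
         (\<forall>k\<ge>2. sup_deriv a b v k \<ge> real ((k - 2) choose nat \<lceil>real (k - 2) / 2\<rceil>) \<and>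
                 \<bar>inf_deriv a b v k\<bar> \<ge> real ((k - 2) choose nat \<lceil>real (k - 2) / 2\<rceil>))"
proof -
  let ?V = "deriv_values a b v"
  note bdd = bounded_deriv_values[OF less_imp_le[OF assms(3)] assms(5)]
  have ne2: "?V k \<noteq> {}" if "k \<ge> 2" for k
    using binomials_in_deriv_values[OF assms that, of 0] by blast
  \<comment> \<open>Order 1 inherits nonemptiness from order 2, where the two arms supply a
    value.\<close>
  have ne: "?V k \<noteq> {}" if "k \<ge> 1" for k
    using deriv_values_Suc[of _ a b v k] ne2[of "Suc k"] that by fastforce
  have "sup_deriv a b v (k + 1) \<le> sup_deriv a b v k - inf_deriv a b v k \<and>
        inf_deriv a b v (k + 1) \<ge> inf_deriv a b v k - sup_deriv a b v k" if "k \<ge> 1" for k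
  proof -
    have "Inf (?V k) - Sup (?V k) \<le> x \<and> x \<le> Sup (?V k) - Inf (?V k)" if x: "x \<in> ?V (k + 1)" for x
    proof -
      obtain y z where "y \<in> ?V k" "z \<in> ?V k" "x = y - z"
        using deriv_values_Suc[of x a b v k] x by auto
      moreover have "Inf (?V k) \<le> y" "y \<le> Sup (?V k)" "Inf (?V k) \<le> z" "z \<le> Sup (?V k)"
        using calculation bdd[OF \<open>k \<ge> 1\<close>] by (auto intro: cInf_lower cSup_upper)
      ultimately show ?thesis by linarith
    qed
    then have "Sup (?V (k + 1)) \<le> Sup (?V k) - Inf (?V k)" "Inf (?V k) - Sup (?V k) \<le> Inf (?V (k + 1))"
      using ne[of "k + 1"] by (auto intro!: cSup_least cInf_greatest)
    then show ?thesis
      using assms(3) unfolding sup_deriv_def inf_deriv_def right_diff_distrib[symmetric]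
      by (auto intro!: divide_right_mono)
  qed
  moreover have "sup_deriv a b v k \<le> 2 ^ (k - 2) \<and> \<bar>inf_deriv a b v k\<bar> \<le> 2 ^ (k - 2)" if "k \<ge> 2" for k
  proof -
    have abs: "\<bar>x\<bar> \<le> 2 ^ (k - 2) * (b - a)" if "x \<in> ?V k" for x
      using deriv_values_bounded[OF less_imp_le[OF assms(3)] assms(5) \<open>k \<ge> 2\<close> that] .
    have "Sup (?V k) \<le> 2 ^ (k - 2) * (b - a)"
      using ne2[OF that] abs by (intro cSup_least) (auto simp: abs_le_iff)
    moreover have "- (2 ^ (k - 2) * (b - a)) \<le> Inf (?V k)"
      using ne2[OF that] abs by (intro cInf_greatest) (auto simp: abs_le_iff minus_le_iff)
    \<comment> \<open>With the bound on the supremum this bounds the infimum from above, which its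
      absolute value requires as well.\<close>
    moreover have "Inf (?V k) \<le> Sup (?V k)"
      using ne2[OF that] bdd[of k] that by (intro cInf_le_cSup) auto
    ultimately show ?thesis
      using assms(3) by (auto simp: sup_deriv_def inf_deriv_def abs_le_iff field_simps)
  qed
  moreover have "sup_deriv a b v k \<ge> real ((k - 2) choose nat \<lceil>real (k - 2) / 2\<rceil>) \<and>
      \<bar>inf_deriv a b v k\<bar> \<ge> real ((k - 2) choose nat \<lceil>real (k - 2) / 2\<rceil>)" if "k \<ge> 2" for k
  proof -
    define B where "B = real ((k - 2) choose nat \<lceil>real (k - 2) / 2\<rceil>)"
    have "nat \<lceil>real (k - 2) / 2\<rceil> \<le> k - 2" by linarith
    then have "(b - a) * B \<in> ?V k" "- ((b - a) * B) \<in> ?V k"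
      unfolding B_def using binomials_in_deriv_values[OF assms that] by blast+
    then have "(b - a) * B \<le> Sup (?V k)" "Inf (?V k) \<le> - ((b - a) * B)"
      using bdd[of k] that by (auto intro: cSup_upper cInf_lower)
    then have "B \<le> sup_deriv a b v k" "inf_deriv a b v k \<le> - B"
      using assms(3) by (auto simp: sup_deriv_def inf_deriv_def field_simps)
    then show ?thesis unfolding B_def by linarith
  qed
  ultimately show ?thesis by blast
qed

end
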